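(* Let $S$ be a set. Then the Gödel algebra $\mathsf{CC}(\mathsf{2}^S)^*$ is free over $S$ via the map $r\colon S\to \mathsf{CC}(\mathsf{2}^S)^*$ given by $r(s)=\Box U_s=\{C\in \mathsf{CC}(\mathsf{2}^S)\mid C\subseteq U_s\}$, where $U_s=\{(a_i)_{i\in S}\in\mathsf{2}^S\mid a_s=1\}$.
   Context: $\mathsf{2}$ is the two-element chain $0<1$ with the discrete topology, and $\mathsf{2}^S$ carries the product topology and the componentwise order; it is a Priestley space (compact space with partial order such that $x\not\le y$ implies a clopen upset containing $x$ but not $y$). For a Priestley space $X$, $\mathsf{CC}(X)$ is the set of nonempty closed totally ordered subsets of $X$, with topology generated by $\Box V=\{C\mid C\subseteq V\}$ and $\Diamond V=\{C\mid C\cap V\ne\varnothing\}$ for $V$ clopen in $X$, and order $C_1\unlhd C_2$ iff $C_2\subseteq C_1$ and $C_2$ is an upset of $C_1$. For an Esakia space $Y$ (Priestley space where the downset of every clopen set is clopen), $Y^*$ is the Heyting algebra of clopen upsets of $Y$ with $U\to V=Y\setminus{\downarrow}(U\setminus V)$. A Gödel algebra is a Heyting algebra satisfying $(x\to y)\vee(y\to x)=1$. A Gödel algebra $G$ is free over a set $S$ via a function $q\colon S\to G$ if for every Gödel algebra $H$ and function $f\colon S\to H$ there is a unique Heyting algebra homomorphism $g\colon G\to H$ with $g\circ q=f$. *)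

theory Defs
  imports "HOL-Analysis.Abstract_Topology" "HOL-Analysis.Function_Topology" "HOL-Algebra.Lattice"
begin

section \<open>Heyting algebras and Goedel algebras\<close>

text \<open>The operations meet, join, bottom and top are those of the underlying bounded lattice;
  only the implication is an additional component of the structure.\<close>

record 'a heyting = "'a gorder" +
  imp :: "'a \<Rightarrow> 'a \<Rightarrow> 'a" (infixr \<open>\<Rrightarrow>\<index>\<close> 60)

locale heyting_algebra = bounded_lattice L for L (structure) +
  assumes imp_closed: "\<lbrakk>x \<in> carrier L; y \<in> carrier L\<rbrakk> \<Longrightarrow> x \<Rrightarrow> y \<in> carrier L"
    and residuation: "\<lbrakk>x \<in> carrier L; y \<in> carrier L; z \<in> carrier L\<rbrakk>
      \<Longrightarrow> z \<sqsubseteq> x \<Rrightarrow> y \<longleftrightarrow> z \<sqinter> x \<sqsubseteq> y"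

locale goedel_algebra = heyting_algebra +
  assumes prelinearity: "\<lbrakk>x \<in> carrier L; y \<in> carrier L\<rbrakk> \<Longrightarrow> (x \<Rrightarrow> y) \<squnion> (y \<Rrightarrow> x) = \<top>"

definition heyting_hom :: "'a heyting \<Rightarrow> 'b heyting \<Rightarrow> ('a \<Rightarrow> 'b) set" where
  "heyting_hom G H = {h. h \<in> carrier G \<rightarrow> carrier H \<and>
     h \<bottom>\<^bsub>G\<^esub> = \<bottom>\<^bsub>H\<^esub> \<and> h \<top>\<^bsub>G\<^esub> = \<top>\<^bsub>H\<^esub> \<and>
     (\<forall>x\<in>carrier G. \<forall>y\<in>carrier G.
        h (x \<sqinter>\<^bsub>G\<^esub> y) = h x \<sqinter>\<^bsub>H\<^esub> h y \<and>
        h (x \<squnion>\<^bsub>G\<^esub> y) = h x \<squnion>\<^bsub>H\<^esub> h y \<and>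
        h (x \<Rrightarrow>\<^bsub>G\<^esub> y) = h x \<Rrightarrow>\<^bsub>H\<^esub> h y)}"

text \<open>HOL cannot quantify over types inside a formula, so the type of the elements of the test
  algebras \<open>H\<close> is a parameter; a theorem polymorphic in it covers all Goedel algebras.
  Homomorphisms are taken extensional, so that uniqueness means uniqueness on the carrier.\<close>

definition free_goedel_over ::
  "'h itself \<Rightarrow> 's set \<Rightarrow> ('s \<Rightarrow> 'a) \<Rightarrow> 'a heyting \<Rightarrow> bool" where
  "free_goedel_over _ S q G \<longleftrightarrow>
     goedel_algebra G \<and> q \<in> S \<rightarrow> carrier G \<and>
     (\<forall>(H :: 'h heyting) f. goedel_algebra H \<and> f \<in> S \<rightarrow> carrier H \<longrightarrow>
        (\<exists>!g. g \<in> heyting_hom G H \<and> g \<in> extensional (carrier G) \<and> (\<forall>s\<in>S. g (q s) = f s)))"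


section \<open>Ordered topological spaces\<close>

text \<open>The order is only meaningful on \<open>topspace (topo X)\<close>.\<close>

record 'a ordered_space =
  topo :: "'a topology"
  leq :: "'a \<Rightarrow> 'a \<Rightarrow> bool"

definition clopenin :: "'a topology \<Rightarrow> 'a set \<Rightarrow> bool" where
  "clopenin T V \<longleftrightarrow> openin T V \<and> closedin T V"

definition upset_of :: "('a \<Rightarrow> 'a \<Rightarrow> bool) \<Rightarrow> 'a set \<Rightarrow> 'a set \<Rightarrow> bool" where
  "upset_of r A U \<longleftrightarrow> U \<subseteq> A \<and> (\<forall>x\<in>U. \<forall>y\<in>A. r x y \<longrightarrow> y \<in> U)"

definition downset :: "'a ordered_space \<Rightarrow> 'a set \<Rightarrow> 'a set" where
  "downset X A = {x \<in> topspace (topo X). \<exists>a\<in>A. leq X x a}"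

text \<open>The formula for \<open>Y\<^sup>*\<close> makes sense for every ordered space. It yields a
  Heyting algebra when \<open>Y\<close> is an Esakia space.\<close>

definition dual_algebra :: "'a ordered_space \<Rightarrow> 'a set heyting" where
  "dual_algebra Y =
    \<lparr>carrier = {U. clopenin (topo Y) U \<and> upset_of (leq Y) (topspace (topo Y)) U},
     eq = (=), le = (\<subseteq>),
     imp = (\<lambda>U V. topspace (topo Y) - downset Y (U - V))\<rparr>"


section \<open>The space of nonempty closed chains\<close>

definition closed_chains :: "'a ordered_space \<Rightarrow> 'a set set" where
  "closed_chains X =
    {C. C \<noteq> {} \<and> closedin (topo X) C \<and> Complete_Partial_Order.chain (leq X) C}"

definition Box :: "'a ordered_space \<Rightarrow> 'a set \<Rightarrow> 'a set set" where
  "Box X V = {C \<in> closed_chains X. C \<subseteq> V}"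

definition Diamond :: "'a ordered_space \<Rightarrow> 'a set \<Rightarrow> 'a set set" where
  "Diamond X V = {C \<in> closed_chains X. C \<inter> V \<noteq> {}}"

definition CC :: "'a ordered_space \<Rightarrow> 'a set ordered_space" where
  "CC X =
    \<lparr>topo = topology_generated_by
        ({Box X V |V. clopenin (topo X) V} \<union> {Diamond X V |V. clopenin (topo X) V}),
     leq = (\<lambda>C D. D \<subseteq> C \<and> upset_of (leq X) C D)\<rparr>"

lemma topspace_CC: "topspace (topo (CC X)) = closed_chains X"
proof -
  have "Box X (topspace (topo X)) = closed_chains X"
    by (auto simp: Box_def closed_chains_def dest: closedin_subset)
  moreover have "clopenin (topo X) (topspace (topo X))"
    by (simp add: clopenin_def)
  ultimately have "closed_chains X \<in> {Box X V |V. clopenin (topo X) V}"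
    by blast
  moreover have "topspace (topo (CC X)) =
      \<Union>({Box X V |V. clopenin (topo X) V} \<union> {Diamond X V |V. clopenin (topo X) V})"
    unfolding CC_def by (simp only: ordered_space.select_convs topology_generated_by_topspace)
  moreover have "\<dots> \<subseteq> closed_chains X"
    by (auto simp: Box_def Diamond_def)
  ultimately show ?thesis
    by blast
qed


section \<open>The power of the two-element chain\<close>

text \<open>The chain \<open>0 < 1\<close> is \<open>bool\<close> with \<open>False < True\<close>. The points are the functions
  \<open>S \<Rightarrow> bool\<close> that are extensional on \<open>S\<close>.\<close>

definition two_power :: "'s set \<Rightarrow> ('s \<Rightarrow> bool) ordered_space" where
  "two_power S =
    \<lparr>topo = product_topology (\<lambda>_. discrete_topology UNIV) S,
     leq = (\<lambda>a b. \<forall>i\<in>S. a i \<le> b i)\<rparr>"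

definition U_coord :: "'s set \<Rightarrow> 's \<Rightarrow> ('s \<Rightarrow> bool) set" where
  "U_coord S s = {a \<in> topspace (topo (two_power S)). a s = True}"

end

theory Submission
  imports Defs
begin

text \<open>Uniqueness means that the algebra is generated by the sets \<open>\<box>U\<^sub>s\<close>. By compactness of
  \<open>CC(2\<^sup>S)\<close> a clopen set depends only on the restrictions of chains to a finite \<open>F \<subseteq> S\<close>, and two chains
  whose restrictions to \<open>F\<close> are not in the order relation are separated by an implication from a finite
  meet to a finite join of generators, or by an implication from such an element to a generator.

  For existence, let \<open>f\<close> map \<open>S\<close> to a Goedel algebra \<open>H\<close>. The prime filters of \<open>H\<close> above a prime filter \<open>p\<close>
  form a chain, and \<open>q \<mapsto> (s \<mapsto> f s \<in> q)\<close> maps it onto a closed chain \<open>C\<^sub>p\<close> in \<open>2\<^sup>S\<close>. The closed chains above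
  \<open>C\<^sub>p\<close> are exactly the \<open>C\<^sub>q\<close> with \<open>p \<subseteq> q\<close>, so the sets \<open>U\<close> for which some \<open>h \<in> H\<close> satisfies
  \<open>C\<^sub>p \<in> U \<longleftrightarrow> h \<in> p\<close> for all \<open>p\<close> contain the generators and are closed under the Heyting operations.\<close>

section \<open>Prime filters of Heyting and Goedel algebras\<close>

text \<open>The points of \<open>2^S\<close> are the prime filters of the free bounded distributive
  lattice over \<open>S\<close>, but a point alone does not determine the value of an implication,
  which depends on all prime filters above it. In a Goedel algebra these form a chain, so the chain
  of their points is recorded instead of the single point. What spares a duality theory for
  \<open>H\<close> is that in a Goedel algebra every proper filter above a prime filter is prime.
  Prime filters above a given one can then be produced by adjoining an element, by intersection, or
  from finite approximations; Zorn's lemma is applied to filters only to separate two elements. The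
  spectrum of \<open>H\<close> carries no topology here, and compactness is used only for
  \<open>2^S\<close> and \<open>CC(2^S)\<close>. The two halves are linked: the extension of
  \<open>f\<close> is built along the generation of a set from the generators, so the separation
  argument serves existence on the whole carrier as well as uniqueness.\<close>

lemma (in heyting_algebra) imp_mp:
  assumes "x \<in> carrier L" "y \<in> carrier L"
  shows "(x \<Rrightarrow> y) \<sqinter> x \<sqsubseteq> y"
  using residuation[OF assms imp_closed[OF assms]] imp_closed[OF assms] by simp

lemma (in lower_semilattice) meet_mono:
  assumes "a \<sqsubseteq> b" "c \<sqsubseteq> d" "a \<in> carrier L" "b \<in> carrier L" "c \<in> carrier L" "d \<in> carrier L"
  shows "a \<sqinter> c \<sqsubseteq> b \<sqinter> d"
  using assms by (meson le_trans meet_closed meet_le meet_left meet_right)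

context heyting_algebra
begin

definition "is_filter" :: "'a set \<Rightarrow> bool" where
  "is_filter p \<longleftrightarrow> p \<subseteq> carrier L \<and> \<top> \<in> p \<and> (\<forall>x\<in>p. \<forall>y\<in>p. x \<sqinter> y \<in> p) \<and>
     (\<forall>x\<in>p. \<forall>y\<in>carrier L. x \<sqsubseteq> y \<longrightarrow> y \<in> p)"

definition prime_filter :: "'a set \<Rightarrow> bool" where
  "prime_filter p \<longleftrightarrow> is_filter p \<and> \<bottom> \<notin> p \<and>
     (\<forall>x\<in>carrier L. \<forall>y\<in>carrier L. x \<squnion> y \<in> p \<longrightarrow> x \<in> p \<or> y \<in> p)"

lemma is_filterD:
  assumes "is_filter p"
  shows "p \<subseteq> carrier L" "\<top> \<in> p" "\<And>x y. x \<in> p \<Longrightarrow> y \<in> p \<Longrightarrow> x \<sqinter> y \<in> p"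
    "\<And>x y. x \<in> p \<Longrightarrow> x \<sqsubseteq> y \<Longrightarrow> y \<in> carrier L \<Longrightarrow> y \<in> p"
  using assms by (auto simp: is_filter_def)

lemma filter_mp:
  assumes "is_filter p" "x \<in> p" "x \<Rrightarrow> y \<in> p" "y \<in> carrier L"
  shows "y \<in> p"
  using assms is_filterD[OF assms(1)] imp_mp by (metis subsetD)

lemma filter_impI:
  assumes "is_filter p" "w \<in> p" "w \<sqinter> x \<sqsubseteq> y" "x \<in> carrier L" "y \<in> carrier L"
  shows "x \<Rrightarrow> y \<in> p"
  using assms residuation is_filterD[OF assms(1)] imp_closed by (metis subsetD)

lemma filter_meet_iff:
  assumes "is_filter p" "x \<in> carrier L" "y \<in> carrier L"
  shows "x \<sqinter> y \<in> p \<longleftrightarrow> x \<in> p \<and> y \<in> p"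
  using assms is_filterD[OF assms(1)] meet_left meet_right by metis

text \<open>By residuation \<open>x \<Rrightarrow> z \<in> p\<close> holds iff
  \<open>w \<sqinter> x \<sqsubseteq> z\<close> for some \<open>w \<in> p\<close>, so this is the
  filter generated by \<open>p\<close> and \<open>x\<close>.\<close>

lemma filter_adjoin:
  assumes p: "is_filter p" and x: "x \<in> carrier L"
  shows "is_filter {z \<in> carrier L. x \<Rrightarrow> z \<in> p}" (is "is_filter ?q")
    and "p \<subseteq> {z \<in> carrier L. x \<Rrightarrow> z \<in> p}" and "x \<in> {z \<in> carrier L. x \<Rrightarrow> z \<in> p}"
proof -
  note D = is_filterD[OF p]
  have mem: "z \<in> ?q" if "w \<in> p" "w \<sqinter> x \<sqsubseteq> z" "z \<in> carrier L" for w z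
    using filter_impI[OF p that(1,2) x that(3)] that by simp
  show "p \<subseteq> ?q"
    using mem D(1) meet_left[OF _ x] by blast
  show "x \<in> ?q"
    using mem[OF D(2) meet_right[OF top_closed x] x] .
  have "y \<in> ?q" if "a \<in> ?q" "a \<sqsubseteq> y" "y \<in> carrier L" for a y
  proof (rule mem)
    show "x \<Rrightarrow> a \<in> p" using that by simp
    have "x \<Rrightarrow> a \<in> carrier L" "a \<in> carrier L" using that x imp_closed by auto
    then show "(x \<Rrightarrow> a) \<sqinter> x \<sqsubseteq> y"
      using le_trans[OF imp_mp \<open>a \<sqsubseteq> y\<close>] x that(3) by simp
  qed fact
  moreover have "a \<sqinter> b \<in> ?q" if "a \<in> ?q" "b \<in> ?q" for a b
  proof (rule mem)
    let ?w = "(x \<Rrightarrow> a) \<sqinter> (x \<Rrightarrow> b)"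
    show "?w \<in> p" using that D by simp
    have cl: "a \<in> carrier L" "b \<in> carrier L" "x \<Rrightarrow> a \<in> carrier L" "x \<Rrightarrow> b \<in> carrier L"
      using that x imp_closed by auto
    have "?w \<sqinter> x \<sqsubseteq> (x \<Rrightarrow> a) \<sqinter> x" "?w \<sqinter> x \<sqsubseteq> (x \<Rrightarrow> b) \<sqinter> x"
      using cl x by (auto intro!: meet_mono meet_left meet_right)
    then have "?w \<sqinter> x \<sqsubseteq> a" "?w \<sqinter> x \<sqsubseteq> b"
      using imp_mp[of x a] imp_mp[of x b] cl x le_trans by (meson meet_closed)+
    then show "?w \<sqinter> x \<sqsubseteq> a \<sqinter> b"
      using cl x by (simp add: meet_le)
    show "a \<sqinter> b \<in> carrier L" using cl by simp
  qed
  moreover have "\<top> \<in> ?q"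
    using \<open>p \<subseteq> ?q\<close> D by blast
  ultimately show "is_filter ?q"
    unfolding is_filter_def by blast
qed

text \<open>Zorn's lemma gives a filter \<open>p\<close> maximal among those containing
  \<open>x\<close> and omitting \<open>y\<close>. By maximality, adjoining any \<open>a\<close>
  outside \<open>p\<close> would bring in \<open>y\<close>, so
  \<open>a \<Rrightarrow> y \<in> p\<close>. If \<open>a\<close> and \<open>b\<close> are both
  outside, the meet \<open>w\<close> of the two implications satisfies
  \<open>a \<squnion> b \<sqsubseteq> w \<Rrightarrow> y\<close>; hence
  \<open>a \<squnion> b \<in> p\<close> would force \<open>y \<in> p\<close>.\<close>

lemma prime_filter_exists:
  assumes x: "x \<in> carrier L" and y: "y \<in> carrier L" and "\<not> x \<sqsubseteq> y"
  obtains p where "prime_filter p" "x \<in> p" "y \<notin> p"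
proof -
  define A where "A = {p. is_filter p \<and> x \<in> p \<and> y \<notin> p}"
  have "is_filter {z \<in> carrier L. x \<sqsubseteq> z}"
    unfolding is_filter_def using x by (auto intro: meet_le le_trans)
  then have "A \<noteq> {}"
    unfolding A_def using assms by (metis (mono_tags, lifting) empty_iff le_refl mem_Collect_eq)
  moreover have "\<Union>\<C> \<in> A" if "\<C> \<noteq> {}" "subset.chain A \<C>" for \<C>
  proof -
    have A: "is_filter p" "x \<in> p" "y \<notin> p" if "p \<in> \<C>" for p
      using that \<open>subset.chain A \<C>\<close> by (auto simp: A_def subset.chain_def)
    have tot: "p \<subseteq> q \<or> q \<subseteq> p" if "p \<in> \<C>" "q \<in> \<C>" for p q
      using that \<open>subset.chain A \<C>\<close> by (auto simp: subset_chain_def)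
    have "a \<sqinter> b \<in> \<Union>\<C>" if ab: "a \<in> \<Union>\<C>" "b \<in> \<Union>\<C>" for a b
    proof -
      obtain p q where "p \<in> \<C>" "q \<in> \<C>" "a \<in> p" "b \<in> q" using ab by blast
      then show ?thesis
        using tot[of p q] A(1) is_filterD(3) by (meson UnionI subsetD)
    qed
    moreover have "y \<in> \<Union>\<C>" if "a \<in> \<Union>\<C>" "a \<sqsubseteq> y" "y \<in> carrier L" for a y
      using that A(1) is_filterD(4) by blast
    moreover have "\<Union>\<C> \<subseteq> carrier L" "\<top> \<in> \<Union>\<C>"
      using A(1) is_filterD(1,2) \<open>\<C> \<noteq> {}\<close> by blast+
    ultimately have "is_filter (\<Union>\<C>)"
      unfolding is_filter_def by blast
    then show ?thesis
      using A \<open>\<C> \<noteq> {}\<close> by (auto simp: A_def)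
  qed
  ultimately obtain p where "p \<in> A" and max: "\<forall>q\<in>A. p \<subseteq> q \<longrightarrow> q = p"
    using subset_Zorn_nonempty[of A] by blast
  then have p: "is_filter p" "x \<in> p" "y \<notin> p" by (auto simp: A_def)
  note D = is_filterD[OF p(1)]
  have imp: "a \<Rrightarrow> y \<in> p" if "a \<in> carrier L" "a \<notin> p" for a
  proof (rule ccontr)
    assume "a \<Rrightarrow> y \<notin> p"
    then have "{z \<in> carrier L. a \<Rrightarrow> z \<in> p} \<in> A"
      using filter_adjoin[OF p(1) that(1)] p by (auto simp: A_def)
    then show False
      using max filter_adjoin[OF p(1) that(1)] that by metis
  qed
  have "a \<in> p \<or> b \<in> p" if "a \<in> carrier L" "b \<in> carrier L" "a \<squnion> b \<in> p" for a b
  proof (rule ccontr)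
    assume "\<not> ?thesis"
    then have *: "a \<Rrightarrow> y \<in> p" "b \<Rrightarrow> y \<in> p" using imp that by auto
    define w where "w = (a \<Rrightarrow> y) \<sqinter> (b \<Rrightarrow> y)"
    have w: "w \<in> p" "w \<in> carrier L" "w \<sqsubseteq> a \<Rrightarrow> y" "w \<sqsubseteq> b \<Rrightarrow> y"
      unfolding w_def using * D meet_left meet_right by (auto simp: subset_iff)
    then have "w \<sqinter> a \<sqsubseteq> y" "w \<sqinter> b \<sqsubseteq> y"
      using residuation that y by auto
    then have "a \<sqsubseteq> w \<Rrightarrow> y" "b \<sqsubseteq> w \<Rrightarrow> y"
      using residuation that y w meet_comm by metis+
    then have "a \<squnion> b \<sqsubseteq> w \<Rrightarrow> y"
      using that y w imp_closed by (simp add: join_le)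
    then have "w \<Rrightarrow> y \<in> p"
      using D(4) that(3) y w imp_closed by blast
    then show False
      using filter_mp p w y by blast
  qed
  moreover have "\<bottom> \<notin> p"
    using D(4)[of "\<bottom>" y] p y by auto
  ultimately show ?thesis
    using that p unfolding prime_filter_def by blast
qed

lemma prime_filter_join_iff:
  assumes "prime_filter p" "x \<in> carrier L" "y \<in> carrier L"
  shows "x \<squnion> y \<in> p \<longleftrightarrow> x \<in> p \<or> y \<in> p"
  using assms is_filterD(4)[of p] join_left join_right unfolding prime_filter_def
  by (metis join_closed)

lemma eq_if_same_prime_filters:
  assumes "x \<in> carrier L" "y \<in> carrier L" "\<And>p. prime_filter p \<Longrightarrow> x \<in> p \<longleftrightarrow> y \<in> p"
  shows "x = y"
  using assms prime_filter_exists by (metis le_antisym)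

end

section \<open>Consequences of prelinearity for prime filters\<close>

context goedel_algebra
begin

text \<open>Prelinearity puts \<open>a \<Rrightarrow> b\<close> or \<open>b \<Rrightarrow> a\<close>
  into the prime filter \<open>p\<close>, hence into \<open>q\<close>. In the first case \<open>a
  \<squnion> b \<sqsubseteq> (a \<Rrightarrow> b) \<Rrightarrow> b\<close> turns
  \<open>a \<squnion> b \<in> q\<close> into \<open>b \<in> q\<close>; the other case is symmetric.
  This fails in general Heyting algebras.\<close>

lemma prime_filter_superset:
  assumes p: "prime_filter p" and q: "is_filter q" "p \<subseteq> q" "\<bottom> \<notin> q"
  shows "prime_filter q"
proof -
  have *: "b \<in> q" if ab: "a \<in> carrier L" "b \<in> carrier L" "a \<squnion> b \<in> q" "a \<Rrightarrow> b \<in> p" for a b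
  proof -
    have r: "a \<Rrightarrow> b \<in> carrier L" by (simp add: ab imp_closed)
    have "a \<sqsubseteq> (a \<Rrightarrow> b) \<Rrightarrow> b"
      using imp_mp[OF ab(1,2)] residuation[OF r ab(2,1)] by (metis meet_comm)
    moreover have "b \<sqsubseteq> (a \<Rrightarrow> b) \<Rrightarrow> b"
      using ab r residuation[of "a \<Rrightarrow> b" b b] meet_left by simp
    ultimately have "a \<squnion> b \<sqsubseteq> (a \<Rrightarrow> b) \<Rrightarrow> b"
      using ab r imp_closed by (simp add: join_le)
    then have "(a \<Rrightarrow> b) \<Rrightarrow> b \<in> q"
      using is_filterD(4)[OF q(1) ab(3)] ab r imp_closed by blast
    then show ?thesis
      using filter_mp[OF q(1)] ab q(2) by blast
  qed
  have "a \<in> q \<or> b \<in> q" if ab: "a \<in> carrier L" "b \<in> carrier L" "a \<squnion> b \<in> q" for a b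
  proof -
    have "(a \<Rrightarrow> b) \<squnion> (b \<Rrightarrow> a) \<in> p"
      using prelinearity ab p by (simp add: prime_filter_def is_filter_def)
    then have "a \<Rrightarrow> b \<in> p \<or> b \<Rrightarrow> a \<in> p"
      using p ab by (simp add: prime_filter_join_iff imp_closed)
    then show ?thesis
      using *[of a b] *[of b a] ab join_comm by metis
  qed
  then show ?thesis
    using q unfolding prime_filter_def by blast
qed

text \<open>For witnesses \<open>a\<close>, \<open>b\<close> of incomparability, whichever of the
  two implications lies in \<open>p\<close> moves one witness into the filter that was to omit
  it.\<close>

lemma prime_filters_above_total:
  assumes p: "prime_filter p" and q: "is_filter q" "p \<subseteq> q" and r: "is_filter r" "p \<subseteq> r"
  shows "q \<subseteq> r \<or> r \<subseteq> q"
proof (rule ccontr)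
  assume "\<not> ?thesis"
  then obtain a b where ab: "a \<in> q" "a \<notin> r" "b \<in> r" "b \<notin> q" by blast
  then have c: "a \<in> carrier L" "b \<in> carrier L"
    using is_filterD(1) q r by blast+
  have "(a \<Rrightarrow> b) \<squnion> (b \<Rrightarrow> a) \<in> p"
    using prelinearity c p by (simp add: prime_filter_def is_filter_def)
  then have "a \<Rrightarrow> b \<in> p \<or> b \<Rrightarrow> a \<in> p"
    using p c by (simp add: prime_filter_join_iff imp_closed)
  then show False
    using filter_mp[OF q(1)] filter_mp[OF r(1)] ab c q(2) r(2) by blast
qed

text \<open>The Kripke clause for implication. If \<open>x \<Rrightarrow> y \<notin> p\<close>, the
  counterexample is the filter generated by \<open>p\<close> and \<open>x\<close>: it omits
  \<open>y\<close>, so it is proper and hence prime by \<open>prime_filter_superset\<close>.\<close>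

lemma prime_filter_imp_iff:
  assumes p: "prime_filter p" and x: "x \<in> carrier L" and y: "y \<in> carrier L"
  shows "x \<Rrightarrow> y \<in> p \<longleftrightarrow> (\<forall>q. prime_filter q \<and> p \<subseteq> q \<longrightarrow> x \<in> q \<longrightarrow> y \<in> q)"
proof
  assume "x \<Rrightarrow> y \<in> p"
  then show "\<forall>q. prime_filter q \<and> p \<subseteq> q \<longrightarrow> x \<in> q \<longrightarrow> y \<in> q"
    using filter_mp y unfolding prime_filter_def by blast
next
  assume *: "\<forall>q. prime_filter q \<and> p \<subseteq> q \<longrightarrow> x \<in> q \<longrightarrow> y \<in> q"
  let ?q = "{z \<in> carrier L. x \<Rrightarrow> z \<in> p}"
  have "is_filter p" using p by (simp add: prime_filter_def)
  note q = filter_adjoin[OF this x]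
  show "x \<Rrightarrow> y \<in> p"
  proof (rule ccontr)
    assume "x \<Rrightarrow> y \<notin> p"
    then have "y \<notin> ?q" by simp
    moreover from this have "\<bottom> \<notin> ?q"
      using is_filterD(4)[OF q(1), of "\<bottom>" y] y by blast
    then have "prime_filter ?q"
      using prime_filter_superset p q by blast
    ultimately show False using * q by blast
  qed
qed

end

section \<open>Compactness of the space of closed chains\<close>

lemma clopenin_Int [intro]: "clopenin T U \<Longrightarrow> clopenin T V \<Longrightarrow> clopenin T (U \<inter> V)"
  by (auto simp: clopenin_def)

lemma clopenin_Un [intro]: "clopenin T U \<Longrightarrow> clopenin T V \<Longrightarrow> clopenin T (U \<union> V)"
  by (auto simp: clopenin_def)

lemma clopenin_empty [intro]: "clopenin T {}"
  by (auto simp: clopenin_def)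

lemma clopenin_topspace [intro]: "clopenin T (topspace T)"
  by (auto simp: clopenin_def)

lemma clopenin_Diff [intro]: "clopenin T U \<Longrightarrow> clopenin T (topspace T - U)"
  by (auto simp: clopenin_def)

lemma compact_spaceD_cover:
  assumes "compact_space T" "\<forall>V\<in>\<C>. openin T V" "topspace T \<subseteq> \<Union>\<C>"
  obtains \<F> where "finite \<F>" "\<F> \<subseteq> \<C>" "topspace T \<subseteq> \<Union>\<F>"
  using assms(1)[unfolded compact_space_alt, THEN spec, THEN mp, OF conjI[OF assms(2,3)]] that by blast

text \<open>\<open>r F x\<close> is what a finite \<open>F\<close> reveals about \<open>x\<close>.
  Every point has an \<open>F\<close> that decides membership in \<open>U\<close> on its whole
  class; compactness leaves finitely many classes, and the union of their index sets works
  everywhere. The observation is abstract because two are needed: restriction of points of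
  \<open>2^S\<close> and traces of chains.\<close>

lemma clopenin_finitely_determined:
  fixes r :: "'s set \<Rightarrow> 'a \<Rightarrow> 'b"
  assumes "compact_space T"
    and refine: "\<And>F G x y. \<lbrakk>F \<subseteq> G; r G x = r G y\<rbrakk> \<Longrightarrow> r F x = r F y"
    and cyl: "\<And>F x. \<lbrakk>finite F; F \<subseteq> S; x \<in> topspace T\<rbrakk> \<Longrightarrow> openin T {y \<in> topspace T. r F y = r F x}"
    and base: "\<And>V x. \<lbrakk>openin T V; x \<in> V\<rbrakk> \<Longrightarrow>
      \<exists>F. finite F \<and> F \<subseteq> S \<and> (\<forall>y\<in>topspace T. r F y = r F x \<longrightarrow> y \<in> V)"
    and U: "clopenin T U"
  obtains F where "finite F" "F \<subseteq> S"
    "\<And>x y. \<lbrakk>x \<in> topspace T; y \<in> topspace T; r F x = r F y\<rbrakk> \<Longrightarrow> x \<in> U \<longleftrightarrow> y \<in> U"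
proof -
  have "\<exists>F. finite F \<and> F \<subseteq> S \<and> (\<forall>y\<in>topspace T. r F y = r F x \<longrightarrow> (y \<in> U \<longleftrightarrow> x \<in> U))"
    if "x \<in> topspace T" for x
  proof (cases "x \<in> U")
    case True
    then show ?thesis using base[of U x] U by (auto simp: clopenin_def)
  next
    case False
    then show ?thesis using base[of "topspace T - U" x] U that by (auto simp: clopenin_def)
  qed
  then obtain f where f: "\<And>x. x \<in> topspace T \<Longrightarrow> finite (f x) \<and> f x \<subseteq> S \<and>
      (\<forall>y\<in>topspace T. r (f x) y = r (f x) x \<longrightarrow> (y \<in> U \<longleftrightarrow> x \<in> U))"
    by metis
  let ?c = "\<lambda>x. {y \<in> topspace T. r (f x) y = r (f x) x}"
  have cover: "\<forall>V\<in>?c ` topspace T. openin T V" "topspace T \<subseteq> \<Union>(?c ` topspace T)"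
    using f cyl by auto
  obtain \<F> where \<F>: "finite \<F>" "\<F> \<subseteq> ?c ` topspace T" "topspace T \<subseteq> \<Union>\<F>"
    by (rule compact_spaceD_cover[OF assms(1) cover])
  obtain A where "A \<subseteq> topspace T" "finite A" "\<F> = ?c ` A"
    using finite_subset_image[OF \<F>(1,2)] by auto
  with \<F> have A: "finite A" "A \<subseteq> topspace T" "topspace T \<subseteq> \<Union>(?c ` A)"
    by auto
  show ?thesis
  proof
    show "finite (\<Union>(f ` A))" "\<Union>(f ` A) \<subseteq> S" using A f by blast+
    fix x y assume x: "x \<in> topspace T" and y: "y \<in> topspace T"
      and eq: "r (\<Union>(f ` A)) x = r (\<Union>(f ` A)) y"
    obtain a where a: "a \<in> A" "r (f a) x = r (f a) a" using A x by blast
    moreover have "r (f a) x = r (f a) y" using refine[OF _ eq] a by blast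
    moreover have "a \<in> topspace T" using A(2) a(1) by (rule subsetD)
    then have "\<forall>y\<in>topspace T. r (f a) y = r (f a) a \<longrightarrow> (y \<in> U \<longleftrightarrow> a \<in> U)" by (rule f[THEN conjunct2, THEN conjunct2])
    ultimately show "x \<in> U \<longleftrightarrow> y \<in> U" using x y by metis
  qed
qed

section \<open>The Vietoris hyperspace of a compact space\<close>

definition Vietoris :: "'a topology \<Rightarrow> 'a set topology" where
  "Vietoris T = topology (arbitrary union_of (finite intersection_of (\<lambda>\<U>. \<U> \<in>
      (\<lambda>V. {K. K \<subseteq> V}) ` {V. openin T V} \<union> (\<lambda>V. {K. K \<inter> V \<noteq> {}}) ` {V. openin T V})
      relative_to {K. closedin T K \<and> K \<noteq> {}}))"

lemma topspace_Vietoris [simp]: "topspace (Vietoris T) = {K. closedin T K \<and> K \<noteq> {}}"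
  unfolding Vietoris_def by (rule topspace_subbase)

lemma openin_Vietoris_box:
  assumes "openin T V"
  shows "openin (Vietoris T) {K. closedin T K \<and> K \<noteq> {} \<and> K \<subseteq> V}"
proof -
  have "{K. closedin T K \<and> K \<noteq> {} \<and> K \<subseteq> V} = {K. closedin T K \<and> K \<noteq> {}} \<inter> {K. K \<subseteq> V}"
    by auto
  with assms show ?thesis
    unfolding Vietoris_def openin_subbase
    by (auto intro!: arbitrary_union_of_inc relative_to_inc finite_intersection_of_inc)
qed

lemma openin_Vietoris_diamond:
  assumes "openin T V"
  shows "openin (Vietoris T) {K. closedin T K \<and> K \<inter> V \<noteq> {}}"
proof -
  have "{K. closedin T K \<and> K \<inter> V \<noteq> {}} = {K. closedin T K \<and> K \<noteq> {}} \<inter> {K. K \<inter> V \<noteq> {}}"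
    by auto
  with assms show ?thesis
    unfolding Vietoris_def openin_subbase
    by (auto intro!: arbitrary_union_of_inc relative_to_inc finite_intersection_of_inc)
qed

text \<open>By Alexander's lemma it suffices to treat covers by boxes and diamonds. The open sets
  \<open>\<W>\<close> of the diamonds, together with that of one suitable box, cover
  \<open>T\<close>; finitely many of them suffice. A closed set that meets none of the chosen
  members of \<open>\<W>\<close> then lies inside the box.\<close>

lemma compact_space_Vietoris:
  assumes T: "compact_space T"
  shows "compact_space (Vietoris T)"
proof (rule Alexander_subbase_alt)
  let ?H = "{K. closedin T K \<and> K \<noteq> {}}"
  let ?box = "\<lambda>V. {K. K \<subseteq> V}" and ?dia = "\<lambda>V. {K. K \<inter> V \<noteq> {}}"
  let ?B = "?box ` {V. openin T V} \<union> ?dia ` {V. openin T V}"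
  show "topology (arbitrary union_of (finite intersection_of (\<lambda>\<U>. \<U> \<in> ?B) relative_to ?H)) = Vietoris T"
    by (simp add: Vietoris_def)
  show "?H \<subseteq> \<Union>?B"
    using closedin_subset by fastforce
  fix \<C> assume C: "\<C> \<subseteq> ?B" "?H \<subseteq> \<Union>\<C>"
  define \<W> where "\<W> = {V. openin T V \<and> ?dia V \<in> \<C>}"
  text \<open>If \<open>K\<close> is nonempty, it is a point of the hyperspace in no diamond of the cover, so a box of the cover contains it.\<close>
  define K where "K = topspace T - \<Union>\<W>"
  \<comment> \<open>At most one box is kept, since a set inside a union of several \<open>V\<close>
    need not lie inside any one of them. The empty family serves the case \<open>K = {}\<close>, in
    which the cover may contain no box.\<close>
  obtain \<V> where V: "\<V> \<subseteq> {V. openin T V \<and> ?box V \<in> \<C>}" "finite \<V>" "K \<subseteq> \<Union>\<V>" "card \<V> \<le> 1"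
  proof (cases "K = {}")
    case True
    then show ?thesis using that[of "{}"] by simp
  next
    case False
    moreover have "openin T (\<Union>\<W>)" by (auto simp: \<W>_def)
    ultimately have "K \<in> ?H" by (auto simp: K_def)
    then obtain c where c: "c \<in> \<C>" "K \<in> c" using C by blast
    have "c \<in> ?B" by (rule subsetD[OF C(1) c(1)])
    then consider V where "openin T V" "c = ?box V" | V where "openin T V" "c = ?dia V"
      by (elim UnE imageE) simp_all
    then show ?thesis
    proof cases
      case 1
      then show ?thesis using that[of "{V}"] c by auto
    next
      case 2
      then have "V \<in> \<W>" using c by (simp add: \<W>_def)
      then show ?thesis using 2 c by (auto simp: K_def)
    qed
  qed
  have "\<forall>V\<in>\<V> \<union> \<W>. openin T V"
    using V(1) by (auto simp: \<W>_def)
  moreover have "topspace T \<subseteq> \<Union>(\<V> \<union> \<W>)"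
    using V(3) by (auto simp: K_def)
  ultimately obtain \<F> where F: "finite \<F>" "\<F> \<subseteq> \<V> \<union> \<W>" "topspace T \<subseteq> \<Union>\<F>"
    by (rule compact_spaceD_cover[OF T])
  let ?C = "?box ` \<V> \<union> ?dia ` (\<F> \<inter> \<W>)"
  have "L \<in> \<Union>?C" if "closedin T L" "L \<noteq> {}" for L
  proof (cases "L \<inter> \<Union>(\<F> \<inter> \<W>) = {}")
    case True
    have "L \<subseteq> topspace T" using that closedin_subset by blast
    then have L: "L \<subseteq> \<Union>\<V>" using True F by blast
    then have "\<V> \<noteq> {}" using that by auto
    then have "card \<V> = 1" using V(2,4) by (simp add: le_Suc_eq)
    then obtain V where "\<V> = {V}" by (auto simp: card_1_singleton_iff)
    then show ?thesis using L by auto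
  next
    case False
    then show ?thesis by auto
  qed
  moreover have "finite ?C" "?C \<subseteq> \<C>" using V F by (auto simp: \<W>_def)
  ultimately show "\<exists>\<C>'. finite \<C>' \<and> \<C>' \<subseteq> \<C> \<and> ?H \<subseteq> \<Union>\<C>'"
    by (intro exI[of _ ?C]) blast
qed

section \<open>Cylinders, clopen sets and closed sets in \<open>2^S\<close>\<close>

lemma restrict_eq_iff: "restrict x F = restrict y F \<longleftrightarrow> (\<forall>s\<in>F. x s = y s)"
  by (auto simp: restrict_def fun_eq_iff)

lemma finite_restrict_image: "finite F \<Longrightarrow> finite ((\<lambda>x. restrict (x :: 's \<Rightarrow> bool) F) ` A)"
  by (rule finite_subset[of _ "PiE F (\<lambda>_. UNIV)"]) (auto intro!: finite_PiE)

lemma leq_two_power: "leq (two_power S) a b \<longleftrightarrow> (\<forall>i\<in>S. a i \<longrightarrow> b i)"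
  by (auto simp: two_power_def)

lemma topspace_two_power: "topspace (topo (two_power S)) = extensional S"
  by (auto simp: two_power_def PiE_def)

lemma compact_space_two_power: "compact_space (topo (two_power S))"
  by (simp add: two_power_def compact_space_product_topology compact_space_discrete_topology)

lemma openin_two_power_cylinder:
  assumes "finite F" "F \<subseteq> S"
  shows "openin (topo (two_power S)) {x \<in> extensional S. restrict x F \<in> A}"
proof (subst openin_subopen, intro ballI)
  fix a assume a: "a \<in> {x \<in> extensional S. restrict x F \<in> A}"
  let ?V = "PiE S (\<lambda>s. if s \<in> F then {a s} else UNIV)"
  have "openin (topo (two_power S)) ?V"
    unfolding two_power_def using assms
    by (simp, intro product_topology_basis) (auto intro: finite_subset[OF _ assms(1)])
  moreover have "a \<in> ?V" using a by (auto simp: PiE_def)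
  moreover have "?V \<subseteq> {x \<in> extensional S. restrict x F \<in> A}"
  proof
    fix x assume x: "x \<in> ?V"
    then have "restrict x F = restrict a F"
      using assms unfolding restrict_eq_iff by (auto simp: PiE_def Pi_def split: if_splits)
    then show "x \<in> {x \<in> extensional S. restrict x F \<in> A}" using a x by (auto simp: PiE_def)
  qed
  ultimately show "\<exists>T. openin (topo (two_power S)) T \<and> a \<in> T \<and> T \<subseteq> {x \<in> extensional S. restrict x F \<in> A}"
    by blast
qed

lemma clopenin_two_power_cylinder:
  assumes "finite F" "F \<subseteq> S"
  shows "clopenin (topo (two_power S)) {x \<in> extensional S. restrict x F \<in> A}"
proof -
  have eq: "extensional S - {x \<in> extensional S. restrict x F \<in> A} = {x \<in> extensional S. restrict x F \<in> - A}"
    by auto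
  have "openin (topo (two_power S)) (extensional S - {x \<in> extensional S. restrict x F \<in> A})"
    unfolding eq by (rule openin_two_power_cylinder[OF assms])
  then show ?thesis
    using openin_two_power_cylinder[OF assms, of A]
    by (simp add: clopenin_def closedin_def topspace_two_power subsetI)
qed

lemma openin_two_power_base:
  assumes "openin (topo (two_power S)) V" "x \<in> V"
  shows "\<exists>F. finite F \<and> F \<subseteq> S \<and> (\<forall>y\<in>extensional S. restrict y F = restrict x F \<longrightarrow> y \<in> V)"
proof -
  have "openin (product_topology (\<lambda>_. discrete_topology (UNIV :: bool set)) S) V"
    using assms by (simp add: two_power_def)
  then obtain U where U: "finite {i \<in> S. U i \<noteq> (UNIV :: bool set)}" "x \<in> PiE S U" "PiE S U \<subseteq> V"
    unfolding openin_product_topology_alt using assms(2) by auto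
  have "y \<in> V" if "y \<in> extensional S" "restrict y {i \<in> S. U i \<noteq> UNIV} = restrict x {i \<in> S. U i \<noteq> UNIV}" for y
  proof -
    have "y i \<in> U i" if "i \<in> S" for i
      using that U(2) \<open>restrict y _ = _\<close> unfolding restrict_eq_iff
      by (cases "U i = UNIV") (auto simp: PiE_def Pi_def)
    then show ?thesis using U(3) \<open>y \<in> extensional S\<close> by (auto simp: PiE_def Pi_def subset_iff)
  qed
  then show ?thesis using U(1) by blast
qed

lemma clopenin_two_power_finitely_determined:
  assumes "clopenin (topo (two_power S)) V"
  obtains (det) F where "finite F" "F \<subseteq> S"
    "\<And>x y. \<lbrakk>x \<in> extensional S; y \<in> extensional S; restrict x F = restrict y F\<rbrakk> \<Longrightarrow> x \<in> V \<longleftrightarrow> y \<in> V"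
proof (rule clopenin_finitely_determined[where r = "\<lambda>F x. restrict x F" and S = S, OF compact_space_two_power _ _ _ assms])
  show "restrict x F = restrict y F" if "F \<subseteq> G" "restrict x G = restrict y G"
    for F G :: "'a set" and x y :: "'a \<Rightarrow> bool"
    using that unfolding restrict_eq_iff by blast
  show "openin (topo (two_power S)) {y \<in> topspace (topo (two_power S)). restrict y F = restrict x F}"
    if "finite F" "F \<subseteq> S" for F x
    using openin_two_power_cylinder[OF that, of "{restrict x F}"] by (simp add: topspace_two_power)
  show "\<exists>F. finite F \<and> F \<subseteq> S \<and> (\<forall>y\<in>topspace (topo (two_power S)). restrict y F = restrict x F \<longrightarrow> y \<in> W)"
    if "openin (topo (two_power S)) W" "x \<in> W" for W x
    using openin_two_power_base[OF that] by (simp add: topspace_two_power)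
  show thesis if "finite F" "F \<subseteq> S" "\<And>x y. \<lbrakk>x \<in> topspace (topo (two_power S));
      y \<in> topspace (topo (two_power S)); restrict x F = restrict y F\<rbrakk> \<Longrightarrow> x \<in> V \<longleftrightarrow> y \<in> V" for F
    by (rule det[OF that[unfolded topspace_two_power]])
qed

text \<open>Closedness as closure under finite approximation, the form in which all later limit
  arguments use it.\<close>

lemma closedin_two_power_iff:
  "closedin (topo (two_power S)) D \<longleftrightarrow> D \<subseteq> extensional S \<and>
     (\<forall>m\<in>extensional S. (\<forall>F. finite F \<longrightarrow> F \<subseteq> S \<longrightarrow> (\<exists>x\<in>D. \<forall>s\<in>F. x s = m s)) \<longrightarrow> m \<in> D)"
  (is "?L \<longleftrightarrow> ?R")
proof
  assume L: ?L
  then have D: "D \<subseteq> extensional S" "openin (topo (two_power S)) (extensional S - D)"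
    by (auto simp: closedin_def topspace_two_power)
  have "m \<in> D" if m: "m \<in> extensional S" "\<And>F. finite F \<Longrightarrow> F \<subseteq> S \<Longrightarrow> \<exists>x\<in>D. \<forall>s\<in>F. x s = m s" for m
  proof (rule ccontr)
    assume "m \<notin> D"
    then obtain F where "finite F" "F \<subseteq> S"
      "\<forall>y\<in>extensional S. restrict y F = restrict m F \<longrightarrow> y \<in> extensional S - D"
      using openin_two_power_base[OF D(2), of m] m by auto
    then show False using m(2)[of F] D(1) unfolding restrict_eq_iff by blast
  qed
  then show ?R using D by blast
next
  assume R: ?R
  have "\<exists>T. openin (topo (two_power S)) T \<and> m \<in> T \<and> T \<subseteq> extensional S - D"
    if m: "m \<in> extensional S - D" for m
  proof -
    obtain F where F: "finite F" "F \<subseteq> S" "\<not> (\<exists>x\<in>D. \<forall>s\<in>F. x s = m s)"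
      using R m by blast
    then show ?thesis
      using openin_two_power_cylinder[OF F(1,2), of "{restrict m F}"] m
      by (intro exI[of _ "{x \<in> extensional S. restrict x F \<in> {restrict m F}}"])
        (auto simp: restrict_eq_iff)
  qed
  then have "openin (topo (two_power S)) (extensional S - D)"
    using openin_subopen by metis
  then show ?L using R by (simp add: closedin_def topspace_two_power)
qed

lemma closed_chains_two_power_iff:
  "C \<in> closed_chains (two_power S) \<longleftrightarrow> C \<noteq> {} \<and> C \<subseteq> extensional S \<and>
     (\<forall>m\<in>extensional S. (\<forall>F. finite F \<longrightarrow> F \<subseteq> S \<longrightarrow> (\<exists>x\<in>C. \<forall>s\<in>F. x s = m s)) \<longrightarrow> m \<in> C) \<and>
     (\<forall>x\<in>C. \<forall>y\<in>C. (\<forall>i\<in>S. x i \<longrightarrow> y i) \<or> (\<forall>i\<in>S. y i \<longrightarrow> x i))"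
  unfolding closed_chains_def closedin_two_power_iff Complete_Partial_Order.chain_def leq_two_power
  by auto

text \<open>Incomparability of two members is witnessed by coordinates \<open>i\<close> and
  \<open>j\<close> and persists for every closed set meeting both \<open>P i j\<close> and
  \<open>P j i\<close>. Hence the chains form a closed, thus compact, part of the Vietoris space.
  Clopen sets are open, so the identity from there to \<open>CC(2^S)\<close> is continuous and
  carries compactness over.\<close>

lemma compact_space_CC_two_power: "compact_space (topo (CC (two_power S)))"
proof -
  let ?X = "two_power S" and ?CC = "closed_chains (two_power S)"
  let ?V = "Vietoris (topo ?X)"
  have sub: "?CC \<subseteq> topspace ?V" by (auto simp: closed_chains_def)
  have "openin ?V (topspace ?V - ?CC)"
  proof (subst openin_subopen, intro ballI)
    fix K assume K: "K \<in> topspace ?V - ?CC"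
    then obtain x y i j where xy: "x \<in> K" "y \<in> K" "i \<in> S" "j \<in> S" "x i" "\<not> y i" "y j" "\<not> x j"
      by (auto simp: closed_chains_def Complete_Partial_Order.chain_def leq_two_power)
    have x: "x \<in> extensional S" "y \<in> extensional S"
      using xy K closedin_subset[of "topo ?X" K] by (auto simp: topspace_two_power)
    define P where "P = (\<lambda>i j. {x \<in> extensional S. restrict x {i, j} \<in> {x. x i \<and> \<not> x j}})"
    have P: "openin (topo ?X) (P i j)" "openin (topo ?X) (P j i)"
      unfolding P_def by (rule openin_two_power_cylinder; use xy in simp)+
    let ?D = "\<lambda>V. {K. closedin (topo ?X) K \<and> K \<inter> V \<noteq> {}}"
    have "openin ?V (?D (P i j) \<inter> ?D (P j i))"
      by (intro openin_Int openin_Vietoris_diamond P)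
    moreover have "K \<in> ?D (P i j) \<inter> ?D (P j i)"
      using K xy x by (auto simp: P_def)
    moreover have "?D (P i j) \<inter> ?D (P j i) \<subseteq> topspace ?V - ?CC"
      using xy by (auto simp: P_def closed_chains_def Complete_Partial_Order.chain_def leq_two_power)
    ultimately show "\<exists>T. openin ?V T \<and> K \<in> T \<and> T \<subseteq> topspace ?V - ?CC" by blast
  qed
  then have "closedin ?V ?CC" using sub by (simp add: closedin_def)
  then have "compact_space (subtopology ?V ?CC)"
    by (intro compact_space_subtopology closedin_compact_space compact_space_Vietoris
        compact_space_two_power)
  moreover have top: "topspace (subtopology ?V ?CC) = ?CC" using sub by auto
  moreover have "continuous_map (subtopology ?V ?CC) (topo (CC ?X)) id"
    unfolding CC_def ordered_space.select_convs
  proof (rule continuous_on_generated_topo)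
    show "id ` topspace (subtopology ?V ?CC) \<subseteq> \<Union>({Box ?X V |V. clopenin (topo ?X) V} \<union> {Diamond ?X V |V. clopenin (topo ?X) V})"
      using topspace_CC[of ?X] unfolding CC_def topology_generated_by_topspace ordered_space.select_convs top by auto
    fix U assume "U \<in> {Box ?X V |V. clopenin (topo ?X) V} \<union> {Diamond ?X V |V. clopenin (topo ?X) V}"
    then obtain V where V: "openin (topo ?X) V" "U = Box ?X V \<or> U = Diamond ?X V"
      by (auto simp: clopenin_def)
    have "\<exists>W. openin ?V W \<and> U = W \<inter> ?CC"
      using V(2)
    proof
      assume "U = Box ?X V"
      then show ?thesis using openin_Vietoris_box[OF V(1)]
        by (intro exI[of _ "{K. closedin (topo ?X) K \<and> K \<noteq> {} \<and> K \<subseteq> V}"]) (auto simp: Box_def closed_chains_def)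
    next
      assume "U = Diamond ?X V"
      then show ?thesis using openin_Vietoris_diamond[OF V(1)]
        by (intro exI[of _ "{K. closedin (topo ?X) K \<and> K \<inter> V \<noteq> {}}"]) (auto simp: Diamond_def closed_chains_def)
    qed
    then show "openin (subtopology ?V ?CC) (id -` U \<inter> topspace (subtopology ?V ?CC))"
      unfolding top openin_subtopology by auto
  qed
  ultimately show ?thesis
    using image_compactin[of "subtopology ?V ?CC" ?CC "topo (CC ?X)" id]
    by (simp add: compact_space_def topspace_CC)
qed

section \<open>Finite traces of chains and the clopen subsets of \<open>CC(2^S)\<close>\<close>

definition trace :: "'s set \<Rightarrow> ('s \<Rightarrow> bool) set \<Rightarrow> ('s \<Rightarrow> bool) set" where
  "trace F C = (\<lambda>x. restrict x F) ` C"

lemma trace_eqD: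
  assumes "trace F C = trace F D" "x \<in> C"
  shows "\<exists>y\<in>D. \<forall>s\<in>F. y s = x s"
proof -
  have "restrict x F \<in> trace F D" using assms unfolding trace_def by blast
  then show ?thesis unfolding trace_def by (auto simp: restrict_eq_iff)
qed

lemma trace_subset_eq:
  assumes "F \<subseteq> G" "trace G C = trace G D"
  shows "trace F C = trace F D"
proof -
  have "trace F A = (\<lambda>x. restrict x F) ` trace G A" for A
    unfolding trace_def image_image using assms(1)
    by (intro image_cong) (simp_all add: Int_absorb1)
  then show ?thesis using assms by simp
qed

lemma mem_closed_chain_extensional: "C \<in> closed_chains (two_power S) \<Longrightarrow> x \<in> C \<Longrightarrow> x \<in> extensional S"
  by (auto simp: closed_chains_two_power_iff)

text \<open>Having the trace of \<open>C\<close> is one box condition (no other restriction occurs)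
  and one diamond condition for each element of \<open>trace F C\<close> (it does occur). The trace
  is finite, so the intersection is open. With \<open>openin_CC_base\<close>, these classes form a
  base.\<close>

lemma openin_CC_trace_class:
  assumes "finite F" "F \<subseteq> S" "C \<in> closed_chains (two_power S)"
  shows "openin (topo (CC (two_power S))) {D \<in> closed_chains (two_power S). trace F D = trace F C}"
proof -
  let ?X = "two_power S"
  define cyl where "cyl = (\<lambda>A. {x :: 'a \<Rightarrow> bool. x \<in> extensional S \<and> restrict x F \<in> A})"
  have cl: "clopenin (topo ?X) (cyl A)" for A
    unfolding cyl_def using clopenin_two_power_cylinder[OF assms(1,2)] .
  have "openin (topo (CC ?X)) (Box ?X (cyl A))" "openin (topo (CC ?X)) (Diamond ?X (cyl A))" for A
    unfolding CC_def using cl by (auto intro!: topology_generated_by_Basis)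
  moreover have "finite (trace F C)" unfolding trace_def by (rule finite_restrict_image[OF assms(1)])
  ultimately have "openin (topo (CC ?X)) (Box ?X (cyl (trace F C)) \<inter> \<Inter>((\<lambda>e. Diamond ?X (cyl {e})) ` trace F C))"
    using assms(3) by (intro openin_Int openin_Inter) (auto simp: closed_chains_def trace_def)
  also have "Box ?X (cyl (trace F C)) \<inter> \<Inter>((\<lambda>e. Diamond ?X (cyl {e})) ` trace F C) =
      {D \<in> closed_chains ?X. trace F D = trace F C}" (is "?l = ?r")
  proof (intro Set.set_eqI iffI)
    fix D assume D: "D \<in> ?l"
    then have "trace F D \<subseteq> trace F C" by (auto simp: Box_def cyl_def trace_def)
    moreover have "trace F C \<subseteq> trace F D"
    proof
      fix e assume "e \<in> trace F C"
      then have "D \<in> Diamond ?X (cyl {e})" using D by blast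
      then show "e \<in> trace F D" by (auto simp: Diamond_def cyl_def trace_def)
    qed
    ultimately show "D \<in> ?r" using D by (auto simp: Box_def)
  next
    fix D assume D: "D \<in> ?r"
    then have "D \<in> Box ?X (cyl (trace F C))"
      using mem_closed_chain_extensional[of D S] by (auto simp: Box_def cyl_def trace_def)
    moreover have "D \<in> Diamond ?X (cyl {e})" if "e \<in> trace F C" for e
    proof -
      have "e \<in> trace F D" using that D by simp
      then obtain x where "x \<in> D" "e = restrict x F" by (auto simp: trace_def)
      then show ?thesis
        using D mem_closed_chain_extensional[of D S x] by (auto simp: Diamond_def cyl_def)
    qed
    ultimately show "D \<in> ?l" by blast
  qed
  finally show ?thesis .
qed

lemma openin_CC_base:
  assumes "openin (topo (CC (two_power S))) W" "C \<in> W"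
  shows "\<exists>F. finite F \<and> F \<subseteq> S \<and> (\<forall>D\<in>closed_chains (two_power S). trace F D = trace F C \<longrightarrow> D \<in> W)"
proof -
  let ?X = "two_power S"
  have "generate_topology_on ({Box ?X V |V. clopenin (topo ?X) V} \<union> {Diamond ?X V |V. clopenin (topo ?X) V}) W"
    using assms(1) unfolding CC_def by (simp add: openin_topology_generated_by_iff)
  then show ?thesis using assms(2)
  proof (induction arbitrary: C)
    case (Int a b)
    obtain F G where F: "finite F" "F \<subseteq> S" "\<forall>D\<in>closed_chains ?X. trace F D = trace F C \<longrightarrow> D \<in> a"
      and G: "finite G" "G \<subseteq> S" "\<forall>D\<in>closed_chains ?X. trace G D = trace G C \<longrightarrow> D \<in> b"
      using Int.IH[of C] Int.prems by blast
    have "D \<in> a \<inter> b" if "D \<in> closed_chains ?X" "trace (F \<union> G) D = trace (F \<union> G) C" for D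
      using F(3) G(3) that(1) trace_subset_eq[OF Un_upper1 that(2)] trace_subset_eq[OF Un_upper2 that(2)]
      by blast
    then show ?case using F(1,2) G(1,2) by (meson Un_least finite_UnI)
  next
    case (UN K)
    then obtain k where k: "k \<in> K" "C \<in> k" by blast
    show ?case using UN.IH[OF k] k(1) by blast
  next
    case (Basis W)
    then obtain V where V: "clopenin (topo ?X) V" "W = Box ?X V \<or> W = Diamond ?X V" by blast
    obtain F where F: "finite F" "F \<subseteq> S" "\<And>x y. \<lbrakk>x \<in> extensional S; y \<in> extensional S;
        restrict x F = restrict y F\<rbrakk> \<Longrightarrow> x \<in> V \<longleftrightarrow> y \<in> V"
      by (rule clopenin_two_power_finitely_determined[OF V(1)]) (rule that; assumption)
    have C: "C \<in> closed_chains ?X" using V(2) Basis.prems by (auto simp: Box_def Diamond_def)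
    have "D \<in> W" if D: "D \<in> closed_chains ?X" "trace F D = trace F C" for D
    proof -
      have *: "\<exists>y\<in>B. x \<in> V \<longleftrightarrow> y \<in> V"
        if "A \<in> closed_chains ?X" "B \<in> closed_chains ?X" "trace F A = trace F B" "x \<in> A" for A B x
      proof -
        note AB = that
        obtain y where y: "y \<in> B" "\<forall>s\<in>F. y s = x s"
          using trace_eqD[OF AB(3,4)] by blast
        then have "restrict x F = restrict y F" by (simp add: restrict_eq_iff)
        then have "x \<in> V \<longleftrightarrow> y \<in> V"
          using mem_closed_chain_extensional AB(1,2,4) y(1) by (intro F(3))
        then show ?thesis using y(1) by blast
      qed
      show ?thesis
        using V(2) Basis.prems *[OF D(1) C D(2)] *[OF C D(1) D(2)[symmetric]] D(1)
        by (auto simp: Box_def Diamond_def)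
    qed
    then show ?case using F(1,2) by blast
  qed simp
qed

text \<open>Compactness supplies a single \<open>F\<close>; conversely, a set saturated for equality
  of traces on \<open>F\<close> is a union of open classes.\<close>

lemma clopenin_CC_two_power_iff:
  "clopenin (topo (CC (two_power S))) W \<longleftrightarrow> W \<subseteq> closed_chains (two_power S) \<and>
     (\<exists>F. finite F \<and> F \<subseteq> S \<and> (\<forall>C\<in>closed_chains (two_power S). \<forall>D\<in>closed_chains (two_power S).
        trace F C = trace F D \<longrightarrow> C \<in> W \<longrightarrow> D \<in> W))"
  (is "?L \<longleftrightarrow> ?R")
proof
  assume L: ?L
  obtain F where F: "finite F" "F \<subseteq> S" "\<And>x y. \<lbrakk>x \<in> topspace (topo (CC (two_power S)));
      y \<in> topspace (topo (CC (two_power S))); trace F x = trace F y\<rbrakk> \<Longrightarrow> x \<in> W \<longleftrightarrow> y \<in> W"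
  proof (rule clopenin_finitely_determined[where r = trace and S = S, OF compact_space_CC_two_power _ _ _ L])
    show "trace F C = trace F D" if "F \<subseteq> G" "trace G C = trace G D" for F G :: "'a set" and C D
      using trace_subset_eq that .
    show "openin (topo (CC (two_power S))) {D \<in> topspace (topo (CC (two_power S))). trace F D = trace F C}"
      if "finite F" "F \<subseteq> S" "C \<in> topspace (topo (CC (two_power S)))" for F C
      using openin_CC_trace_class that unfolding topspace_CC .
    show "\<exists>F. finite F \<and> F \<subseteq> S \<and>
        (\<forall>D\<in>topspace (topo (CC (two_power S))). trace F D = trace F C \<longrightarrow> D \<in> V)"
      if "openin (topo (CC (two_power S))) V" "C \<in> V" for V C
      using openin_CC_base[OF that] unfolding topspace_CC .
  qed (rule that; assumption)
  moreover have "W \<subseteq> closed_chains (two_power S)"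
    using L openin_subset[of _ W] unfolding clopenin_def topspace_CC[symmetric] by blast
  ultimately show ?R using F(1,2) iffD1[OF F(3)] unfolding topspace_CC by blast
next
  assume ?R
  then obtain F where F: "finite F" "F \<subseteq> S" and W: "W \<subseteq> closed_chains (two_power S)"
    and dep: "\<And>C D. \<lbrakk>C \<in> closed_chains (two_power S); D \<in> closed_chains (two_power S);
      trace F C = trace F D; C \<in> W\<rbrakk> \<Longrightarrow> D \<in> W"
    by blast
  have "openin (topo (CC (two_power S))) A"
    if A: "A \<subseteq> closed_chains (two_power S)" "\<And>C D. \<lbrakk>C \<in> closed_chains (two_power S);
      D \<in> closed_chains (two_power S); trace F C = trace F D; C \<in> A\<rbrakk> \<Longrightarrow> D \<in> A" for A
  proof (subst openin_subopen, intro ballI)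
    fix C assume C: "C \<in> A"
    let ?T = "{D \<in> closed_chains (two_power S). trace F D = trace F C}"
    have "C \<in> closed_chains (two_power S)" using C A(1) by blast
    then have "openin (topo (CC (two_power S))) ?T" "C \<in> ?T" "?T \<subseteq> A"
      using openin_CC_trace_class[OF F] A(2)[OF _ _ _ C] by auto
    then show "\<exists>T. openin (topo (CC (two_power S))) T \<and> C \<in> T \<and> T \<subseteq> A" by blast
  qed
  \<comment> \<open>Saturation passes to the complement because the condition is symmetric in the
    two chains; this gives closedness.\<close>
  from this[of W] this[of "closed_chains (two_power S) - W"] show ?L
    using W dep unfolding clopenin_def closedin_def topspace_CC by (metis Diff_iff Diff_subset)
qed

section \<open>The dual algebra\<close>

lemma carrier_dual_algebra:
  "carrier (dual_algebra Y) = {U. clopenin (topo Y) U \<and> upset_of (leq Y) (topspace (topo Y)) U}"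
  by (simp add: dual_algebra_def)

lemma le_dual_algebra: "le (dual_algebra Y) = (\<subseteq>)"
  by (simp add: dual_algebra_def)

lemma dual_algebra_upset:
  assumes "U \<in> carrier (dual_algebra Y)"
  shows "U \<subseteq> topspace (topo Y)" "\<And>x y. \<lbrakk>x \<in> U; y \<in> topspace (topo Y); leq Y x y\<rbrakk> \<Longrightarrow> y \<in> U"
  using assms by (auto simp: carrier_dual_algebra upset_of_def)

lemma mem_imp_dual_algebra:
  assumes "U \<in> carrier (dual_algebra Y)"
  shows "x \<in> imp (dual_algebra Y) U V \<longleftrightarrow>
    x \<in> topspace (topo Y) \<and> (\<forall>y\<in>topspace (topo Y). leq Y x y \<longrightarrow> y \<in> U \<longrightarrow> y \<in> V)"
  using dual_algebra_upset(1)[OF assms] by (auto simp: dual_algebra_def downset_def)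

lemma dual_algebra_closed:
  assumes "U \<in> carrier (dual_algebra Y)" "V \<in> carrier (dual_algebra Y)"
  shows "U \<inter> V \<in> carrier (dual_algebra Y)" "U \<union> V \<in> carrier (dual_algebra Y)"
  using assms by (auto simp: carrier_dual_algebra upset_of_def)

lemma dual_algebra_extremal:
  "{} \<in> carrier (dual_algebra Y)" "topspace (topo Y) \<in> carrier (dual_algebra Y)"
  by (auto simp: carrier_dual_algebra upset_of_def)

lemma partial_order_dual_algebra: "partial_order (dual_algebra Y)"
  by unfold_locales (auto simp: dual_algebra_def)

lemma least_dual_algebra:
  assumes "U \<in> carrier (dual_algebra Y)" "V \<in> carrier (dual_algebra Y)"
  shows "least (dual_algebra Y) (U \<union> V) (Upper (dual_algebra Y) {U, V})"
  using assms dual_algebra_closed[OF assms] by (auto simp: least_def Upper_def le_dual_algebra)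

lemma greatest_dual_algebra:
  assumes "U \<in> carrier (dual_algebra Y)" "V \<in> carrier (dual_algebra Y)"
  shows "greatest (dual_algebra Y) (U \<inter> V) (Lower (dual_algebra Y) {U, V})"
  using assms dual_algebra_closed[OF assms] by (auto simp: greatest_def Lower_def le_dual_algebra)

lemma bounded_lattice_dual_algebra: "bounded_lattice (dual_algebra Y)"
proof -
  interpret partial_order "dual_algebra Y" by (rule partial_order_dual_algebra)
  show ?thesis
  proof unfold_locales
    show "\<exists>x. least (dual_algebra Y) x (carrier (dual_algebra Y))"
      by (intro exI[of _ "{}"]) (auto simp: least_def le_dual_algebra dual_algebra_extremal)
    show "\<exists>x. greatest (dual_algebra Y) x (carrier (dual_algebra Y))"
      using dual_algebra_upset(1)[of _ Y]
      by (intro exI[of _ "topspace (topo Y)"]) (auto simp: greatest_def le_dual_algebra dual_algebra_extremal)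
  qed (use least_dual_algebra greatest_dual_algebra in blast)+
qed

lemma dual_algebra_operations:
  shows "\<lbrakk>U \<in> carrier (dual_algebra Y); V \<in> carrier (dual_algebra Y)\<rbrakk> \<Longrightarrow> U \<squnion>\<^bsub>dual_algebra Y\<^esub> V = U \<union> V"
    and "\<lbrakk>U \<in> carrier (dual_algebra Y); V \<in> carrier (dual_algebra Y)\<rbrakk> \<Longrightarrow> U \<sqinter>\<^bsub>dual_algebra Y\<^esub> V = U \<inter> V"
    and "\<bottom>\<^bsub>dual_algebra Y\<^esub> = {}" and "\<top>\<^bsub>dual_algebra Y\<^esub> = topspace (topo Y)"
proof -
  interpret bounded_lattice "dual_algebra Y" by (rule bounded_lattice_dual_algebra)
  show "U \<squnion>\<^bsub>dual_algebra Y\<^esub> V = U \<union> V" if "U \<in> carrier (dual_algebra Y)" "V \<in> carrier (dual_algebra Y)"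
    using joinI[OF _ that, of "\<lambda>W. W = U \<union> V"] least_unique[OF _ least_dual_algebra[OF that]] by blast
  show "U \<sqinter>\<^bsub>dual_algebra Y\<^esub> V = U \<inter> V" if "U \<in> carrier (dual_algebra Y)" "V \<in> carrier (dual_algebra Y)"
    using meetI[OF _ that, of "\<lambda>W. W = U \<inter> V"] greatest_unique[OF _ greatest_dual_algebra[OF that]] by blast
  show "\<bottom>\<^bsub>dual_algebra Y\<^esub> = {}"
    by (rule bottom_eq[symmetric]) (auto simp: dual_algebra_extremal le_dual_algebra)
  show "\<top>\<^bsub>dual_algebra Y\<^esub> = topspace (topo Y)"
    by (rule top_eq[symmetric]) (auto simp: dual_algebra_extremal le_dual_algebra dest: dual_algebra_upset(1))
qed

lemma goedel_algebra_dual_algebra: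
  assumes reflexive: "\<And>x. x \<in> topspace (topo Y) \<Longrightarrow> leq Y x x"
    and transitive: "\<And>x y z. \<lbrakk>x \<in> topspace (topo Y); y \<in> topspace (topo Y); z \<in> topspace (topo Y);
      leq Y x y; leq Y y z\<rbrakk> \<Longrightarrow> leq Y x z"
    and forest: "\<And>x y z. \<lbrakk>x \<in> topspace (topo Y); y \<in> topspace (topo Y); z \<in> topspace (topo Y);
      leq Y x y; leq Y x z\<rbrakk> \<Longrightarrow> leq Y y z \<or> leq Y z y"
    and esakia: "\<And>U. clopenin (topo Y) U \<Longrightarrow> clopenin (topo Y) (downset Y U)"
  shows "goedel_algebra (dual_algebra Y)"
proof -
  interpret bounded_lattice "dual_algebra Y" by (rule bounded_lattice_dual_algebra)
  have imp: "imp (dual_algebra Y) U V \<in> carrier (dual_algebra Y)"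
    if "U \<in> carrier (dual_algebra Y)" "V \<in> carrier (dual_algebra Y)" for U V
  proof -
    have "U - V = U \<inter> (topspace (topo Y) - V)"
      using dual_algebra_upset(1)[OF that(1)] by auto
    then have "clopenin (topo Y) (U - V)"
      using that by (auto simp: carrier_dual_algebra)
    then have "clopenin (topo Y) (imp (dual_algebra Y) U V)"
      using esakia by (auto simp: dual_algebra_def)
    moreover have "upset_of (leq Y) (topspace (topo Y)) (imp (dual_algebra Y) U V)"
      unfolding upset_of_def
    proof (intro conjI ballI impI)
      show "imp (dual_algebra Y) U V \<subseteq> topspace (topo Y)"
        using mem_imp_dual_algebra[OF that(1)] by blast
      fix x y assume x: "x \<in> imp (dual_algebra Y) U V" and y: "y \<in> topspace (topo Y)" "leq Y x y"
      have "leq Y x z" if "z \<in> topspace (topo Y)" "leq Y y z" for z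
        using x y that transitive[of x y z] mem_imp_dual_algebra[OF \<open>U \<in> _\<close>] by simp
      then show "y \<in> imp (dual_algebra Y) U V"
        using x y(1) unfolding mem_imp_dual_algebra[OF that(1)] by simp
    qed
    ultimately show ?thesis by (simp add: carrier_dual_algebra)
  qed
  show ?thesis
  proof unfold_locales
    fix U V assume U: "U \<in> carrier (dual_algebra Y)" and V: "V \<in> carrier (dual_algebra Y)"
    show "imp (dual_algebra Y) U V \<in> carrier (dual_algebra Y)" using imp U V .
    show "W \<sqsubseteq>\<^bsub>dual_algebra Y\<^esub> imp (dual_algebra Y) U V \<longleftrightarrow> W \<sqinter>\<^bsub>dual_algebra Y\<^esub> U \<sqsubseteq>\<^bsub>dual_algebra Y\<^esub> V"
      if W: "W \<in> carrier (dual_algebra Y)" for W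
      unfolding dual_algebra_operations(2)[OF W U] le_dual_algebra
    proof
      assume sub: "W \<subseteq> imp (dual_algebra Y) U V"
      show "W \<inter> U \<subseteq> V"
      proof
        fix x assume x: "x \<in> W \<inter> U"
        then have "x \<in> imp (dual_algebra Y) U V" using sub by blast
        then show "x \<in> V"
          using x reflexive[of x] unfolding mem_imp_dual_algebra[OF U] by blast
      qed
    next
      assume sub: "W \<inter> U \<subseteq> V"
      show "W \<subseteq> imp (dual_algebra Y) U V"
        unfolding subset_iff mem_imp_dual_algebra[OF U]
        using sub dual_algebra_upset[OF W] by blast
    qed
    \<comment> \<open>A point outside both implications would have some \<open>y\<close> in
      \<open>U - V\<close> and some \<open>z\<close> in \<open>V - U\<close> above it. By
      \<open>forest\<close> these are comparable, and the larger one lies in both upsets, a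
      contradiction.\<close>
    have "topspace (topo Y) \<subseteq> imp (dual_algebra Y) U V \<union> imp (dual_algebra Y) V U"
      unfolding subset_iff Un_iff mem_imp_dual_algebra[OF U] mem_imp_dual_algebra[OF V]
      using dual_algebra_upset[OF U] dual_algebra_upset[OF V] forest by blast
    then show "imp (dual_algebra Y) U V \<squnion>\<^bsub>dual_algebra Y\<^esub> imp (dual_algebra Y) V U = \<top>\<^bsub>dual_algebra Y\<^esub>"
      using imp[OF U V] imp[OF V U] dual_algebra_upset(1)
      by (auto simp: dual_algebra_operations)
  qed
qed

section \<open>The order of \<open>CC(2^S)\<close>: minima, lifting along traces, the Esakia
  property\<close>

lemma leq_CC: "leq (CC X) C D \<longleftrightarrow> D \<subseteq> C \<and> upset_of (leq X) C D"
  by (simp add: CC_def)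

text \<open>The coordinatewise infimum \<open>m\<close> lies in \<open>C\<close> by finite
  approximation. Coordinates are added one at a time: if the member found so far is true at
  \<open>s\<close> but \<open>m\<close> is not, a member that is false at \<open>s\<close> must lie
  below it and replaces it.\<close>

lemma closed_chain_min:
  assumes "C \<in> closed_chains (two_power S)"
  obtains m where "m \<in> C" "\<And>s. s \<in> S \<Longrightarrow> m s \<longleftrightarrow> (\<forall>x\<in>C. x s)"
proof -
  define m where "m = (\<lambda>s\<in>S. \<forall>x\<in>C. x s)"
  note C = assms[unfolded closed_chains_two_power_iff]
  have "\<exists>x\<in>C. \<forall>s\<in>F. x s = m s" if "finite F" "F \<subseteq> S" for F
    using that
  proof (induction F rule: finite_induct)
    case empty
    then show ?case using C by auto
  next
    case (insert s F)
    then obtain x where x: "x \<in> C" "\<forall>t\<in>F. x t = m t" by auto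
    show ?case
    proof (cases "m s")
      case True
      then have "\<forall>x\<in>C. x s" using insert.prems by (simp add: m_def)
      then have "x s" using x(1) by blast
      then show ?thesis using x True by auto
    next
      case False
      then obtain y where y: "y \<in> C" "\<not> y s" using insert.prems by (auto simp: m_def)
      consider "\<forall>i\<in>S. x i \<longrightarrow> y i" | "\<forall>i\<in>S. y i \<longrightarrow> x i" using C x y by blast
      then show ?thesis
      proof cases
        case 1
        then have "\<not> x s" using y insert.prems by blast
        then show ?thesis using x False by auto
      next
        case 2
        have "y t = m t" if "t \<in> F" for t
        proof
          have t: "t \<in> S" using that insert.prems by blast
          assume "y t"
          then show "m t" using 2 t x(2) that by blast
        next
          have t: "t \<in> S" using that insert.prems by blast
          assume "m t"
          then have "\<forall>x\<in>C. x t" using t by (simp add: m_def)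
          then show "y t" using y(1) by blast
        qed
        then show ?thesis using y False by auto
      qed
    qed
  qed
  moreover have "m \<in> extensional S" by (simp add: m_def)
  ultimately have "m \<in> C" using C by blast
  then show ?thesis using that by (simp add: m_def)
qed

lemma closed_chain_limit:
  assumes "C \<in> closed_chains (two_power S)" "m \<in> extensional S"
    and "\<And>F. finite F \<Longrightarrow> F \<subseteq> S \<Longrightarrow> \<exists>x\<in>C. \<forall>s\<in>F. x s = m s"
  shows "m \<in> C"
  using assms unfolding closed_chains_two_power_iff by simp

lemma closed_subchain:
  assumes C: "C \<in> closed_chains (two_power S)" and E: "E \<subseteq> C" "E \<noteq> {}"
    and lim: "\<And>m. \<lbrakk>m \<in> C; \<And>F. finite F \<Longrightarrow> F \<subseteq> S \<Longrightarrow> \<exists>x\<in>E. \<forall>s\<in>F. x s = m s\<rbrakk> \<Longrightarrow> m \<in> E"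
  shows "E \<in> closed_chains (two_power S)"
  unfolding closed_chains_two_power_iff
proof (intro conjI ballI impI)
  show "E \<subseteq> extensional S" using C E(1) mem_closed_chain_extensional by blast
  fix m assume m: "m \<in> extensional S" "\<forall>F. finite F \<longrightarrow> F \<subseteq> S \<longrightarrow> (\<exists>x\<in>E. \<forall>s\<in>F. x s = m s)"
  show "m \<in> E"
  proof (rule lim)
    show app: "\<exists>x\<in>E. \<forall>s\<in>F. x s = m s" if "finite F" "F \<subseteq> S" for F
      using m(2) that by simp
    show "m \<in> C"
    proof (rule closed_chain_limit[OF C m(1)])
      fix F assume "finite F" "F \<subseteq> S"
      then show "\<exists>x\<in>C. \<forall>s\<in>F. x s = m s" using app[of F] E(1) by (meson subsetD)
    qed
  qed
next
  fix x y assume "x \<in> E" "y \<in> E"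
  then have "x \<in> C" "y \<in> C" using E(1) by auto
  then show "(\<forall>i\<in>S. x i \<longrightarrow> y i) \<or> (\<forall>i\<in>S. y i \<longrightarrow> x i)"
    using C unfolding closed_chains_two_power_iff by simp
qed (fact E(2))

text \<open>Every member \<open>c\<close> is the least element of some chain above \<open>C\<close>,
  so a condition on all chains above \<open>C\<close> can be tested at single points of
  \<open>C\<close>.\<close>

lemma closed_chain_up:
  assumes C: "C \<in> closed_chains (two_power S)" and c: "c \<in> C"
  shows "{x \<in> C. \<forall>s\<in>S. c s \<longrightarrow> x s} \<in> closed_chains (two_power S)" (is "?E \<in> _")
    and "leq (CC (two_power S)) C {x \<in> C. \<forall>s\<in>S. c s \<longrightarrow> x s}"
proof -
  show "?E \<in> closed_chains (two_power S)"
  proof (rule closed_subchain[OF C])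
    show "m \<in> ?E" if "m \<in> C" and m: "\<And>F. finite F \<Longrightarrow> F \<subseteq> S \<Longrightarrow> \<exists>x\<in>?E. \<forall>s\<in>F. x s = m s" for m
    proof -
      have "m s" if "s \<in> S" "c s" for s using m[of "{s}"] that by auto
      then show ?thesis using \<open>m \<in> C\<close> by simp
    qed
  qed (use c in auto)
  show "leq (CC (two_power S)) C ?E"
    unfolding leq_CC upset_of_def leq_two_power by blast
qed

text \<open>The hypotheses \<open>sub\<close> and \<open>up\<close> say that, as far as
  \<open>F\<close> can see, \<open>D\<close> is an upset of \<open>C\<close>. The witness is the set
  of all members of \<open>C\<close> whose restriction occurs in \<open>D\<close>; it is closed
  because this condition involves only the finite set \<open>F\<close>.\<close>

lemma trace_lift:
  assumes C: "C \<in> closed_chains (two_power S)" and D: "D \<in> closed_chains (two_power S)"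
    and F: "finite F" "F \<subseteq> S" and sub: "trace F D \<subseteq> trace F C"
    and up: "\<And>c d. \<lbrakk>c \<in> C; d \<in> D; \<forall>s\<in>F. d s \<longrightarrow> c s\<rbrakk> \<Longrightarrow> restrict c F \<in> trace F D"
  obtains E where "E \<in> closed_chains (two_power S)" "leq (CC (two_power S)) C E" "trace F E = trace F D"
proof
  define E where "E = {c \<in> C. restrict c F \<in> trace F D}"
  show tr: "trace F E = trace F D"
  proof
    show "trace F D \<subseteq> trace F E"
    proof
      fix e assume e: "e \<in> trace F D"
      then obtain c where "c \<in> C" "e = restrict c F" using sub unfolding trace_def by blast
      then show "e \<in> trace F E" using e unfolding E_def trace_def by blast
    qed
  qed (auto simp: E_def trace_def)
  show "E \<in> closed_chains (two_power S)"
  proof (rule closed_subchain[OF C])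
    have "D \<noteq> {}" using D by (simp add: closed_chains_two_power_iff)
    then show "E \<noteq> {}" using tr by (auto simp: trace_def)
    show "m \<in> E" if m: "m \<in> C" "\<And>G. finite G \<Longrightarrow> G \<subseteq> S \<Longrightarrow> \<exists>x\<in>E. \<forall>s\<in>G. x s = m s" for m
    proof -
      obtain x where "x \<in> E" "\<forall>s\<in>F. x s = m s" using m(2)[OF F] by blast
      then have "x \<in> E" "restrict x F = restrict m F" by (auto simp: restrict_eq_iff)
      then show ?thesis using m(1) by (simp add: E_def)
    qed
  qed (auto simp: E_def)
  have "y \<in> E" if xy: "x \<in> E" "y \<in> C" "\<forall>s\<in>S. x s \<longrightarrow> y s" for x y
  proof -
    obtain d where d: "d \<in> D" "restrict x F = restrict d F"
      using xy(1) unfolding E_def trace_def by blast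
    then have "\<forall>s\<in>F. d s \<longrightarrow> y s" using xy(3) F(2) unfolding restrict_eq_iff by blast
    then show ?thesis using up[OF xy(2) d(1)] xy(2) by (simp add: E_def)
  qed
  then show "leq (CC (two_power S)) C E"
    unfolding leq_CC upset_of_def leq_two_power by (auto simp: E_def)
qed

text \<open>The Esakia property. The finite set \<open>F\<close> that determines \<open>W\<close>
  also determines its downset: if \<open>D \<in> W\<close> is above \<open>C\<close> and
  \<open>C'\<close> has the trace of \<open>C\<close>, then \<open>trace_lift\<close> produces a
  chain above \<open>C'\<close> with the trace of \<open>D\<close>, and this chain lies in
  \<open>W\<close>.\<close>

lemma clopenin_downset_CC:
  assumes "clopenin (topo (CC (two_power S))) W"
  shows "clopenin (topo (CC (two_power S))) (downset (CC (two_power S)) W)"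
proof -
  obtain F where W: "W \<subseteq> closed_chains (two_power S)" and F: "finite F" "F \<subseteq> S"
    and dep: "\<And>C D. \<lbrakk>C \<in> closed_chains (two_power S); D \<in> closed_chains (two_power S);
      trace F C = trace F D; C \<in> W\<rbrakk> \<Longrightarrow> D \<in> W"
    using assms unfolding clopenin_CC_two_power_iff by blast
  have "C' \<in> downset (CC (two_power S)) W"
    if C: "C \<in> closed_chains (two_power S)" and C': "C' \<in> closed_chains (two_power S)"
      and tr: "trace F C = trace F C'" and mem: "C \<in> downset (CC (two_power S)) W" for C C'
  proof -
    obtain D where D: "D \<in> W" "D \<subseteq> C" "upset_of (leq (two_power S)) C D"
      using mem by (auto simp: downset_def leq_CC)
    obtain E where E: "E \<in> closed_chains (two_power S)" "leq (CC (two_power S)) C' E" "trace F E = trace F D"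
    proof (rule trace_lift[OF C' _ F])
      show "D \<in> closed_chains (two_power S)" using D W by blast
      show "trace F D \<subseteq> trace F C'" unfolding tr[symmetric] using D(2) by (auto simp: trace_def)
      fix c' d assume c': "c' \<in> C'" and d: "d \<in> D" and le: "\<forall>s\<in>F. d s \<longrightarrow> c' s"
      obtain c where c: "c \<in> C" "\<forall>s\<in>F. c s = c' s"
        using trace_eqD[OF tr[symmetric] c'] by blast
      then have r: "restrict c' F = restrict c F" by (simp add: restrict_eq_iff)
      \<comment> \<open>\<open>c\<close> copies \<open>c'\<close> on \<open>F\<close> inside
        \<open>C\<close>, where it is comparable with \<open>d\<close>. Above \<open>d\<close> it
        belongs to the upset \<open>D\<close>; below \<open>d\<close> it agrees with
        \<open>d\<close> on \<open>F\<close>, since \<open>d\<close> is below \<open>c'\<close>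
        there.\<close>
      consider "\<forall>i\<in>S. d i \<longrightarrow> c i" | "\<forall>i\<in>S. c i \<longrightarrow> d i"
        using C c(1) d D(2) unfolding closed_chains_two_power_iff by blast
      then show "restrict c' F \<in> trace F D"
      proof cases
        case 1
        then have "c \<in> D" using D(3) c(1) d unfolding upset_of_def leq_two_power by blast
        then show ?thesis unfolding r trace_def by blast
      next
        case 2
        then have "restrict c F = restrict d F"
          using le c(2) F(2) unfolding restrict_eq_iff by blast
        then show ?thesis using r d unfolding trace_def by auto
      qed
    qed (rule that; assumption)
    have "E \<in> W" using dep[OF _ E(1) E(3)[symmetric] D(1)] D W by blast
    then show ?thesis using C' E by (auto simp: downset_def topspace_CC)
  qed
  moreover have "downset (CC (two_power S)) W \<subseteq> closed_chains (two_power S)"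
    by (auto simp: downset_def topspace_CC)
  ultimately show ?thesis
    unfolding clopenin_CC_two_power_iff using F by blast
qed

lemma leq_CC_refl: "leq (CC X) C C"
  by (auto simp: leq_CC upset_of_def)

lemma goedel_algebra_dual_CC: "goedel_algebra (dual_algebra (CC (two_power S)))"
proof (rule goedel_algebra_dual_algebra)
  show "leq (CC (two_power S)) x x" for x by (rule leq_CC_refl)
  show "leq (CC (two_power S)) x z" if "leq (CC (two_power S)) x y" "leq (CC (two_power S)) y z" for x y z
    using that by (auto simp: leq_CC upset_of_def)
  show "leq (CC (two_power S)) y z \<or> leq (CC (two_power S)) z y"
    if "x \<in> topspace (topo (CC (two_power S)))" and y: "leq (CC (two_power S)) x y" and z: "leq (CC (two_power S)) x z" for x y z
  proof -
    have x: "x \<in> closed_chains (two_power S)" using that by (simp add: topspace_CC)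
    \<comment> \<open>Upsets of the chain \<open>x\<close> are nested.\<close>
    have "y \<subseteq> z \<or> z \<subseteq> y"
    proof (rule ccontr)
      assume "\<not> ?thesis"
      then obtain a b where ab: "a \<in> y" "a \<notin> z" "b \<in> z" "b \<notin> y" by blast
      then have "a \<in> x" "b \<in> x" using y z by (auto simp: leq_CC)
      moreover from this have "(\<forall>i\<in>S. a i \<longrightarrow> b i) \<or> (\<forall>i\<in>S. b i \<longrightarrow> a i)"
        using x unfolding closed_chains_two_power_iff by blast
      ultimately show False
        using ab y z unfolding leq_CC upset_of_def leq_two_power by blast
    qed
    then show ?thesis using y z unfolding leq_CC upset_of_def by blast
  qed
qed (rule clopenin_downset_CC)

section \<open>Generation by the coordinate boxes\<close>

text \<open>The Heyting subalgebra generated by the coordinate boxes. Its induction rule drives both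
  the construction of the extension and the proof of its uniqueness.\<close>

inductive_set generated :: "'s set \<Rightarrow> ('s \<Rightarrow> bool) set set set" for S where
  box: "s \<in> S \<Longrightarrow> Box (two_power S) (U_coord S s) \<in> generated S"
| bot: "{} \<in> generated S"
| top: "closed_chains (two_power S) \<in> generated S"
| inter: "U \<in> generated S \<Longrightarrow> V \<in> generated S \<Longrightarrow> U \<inter> V \<in> generated S"
| union: "U \<in> generated S \<Longrightarrow> V \<in> generated S \<Longrightarrow> U \<union> V \<in> generated S"
| imp: "U \<in> generated S \<Longrightarrow> V \<in> generated S \<Longrightarrow>
    imp (dual_algebra (CC (two_power S))) U V \<in> generated S"

lemma mem_Box_U_coord:
  "C \<in> Box (two_power S) (U_coord S s) \<longleftrightarrow> C \<in> closed_chains (two_power S) \<and> (\<forall>c\<in>C. c s)"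
  using mem_closed_chain_extensional[of C S]
  by (auto simp: Box_def U_coord_def topspace_two_power)

lemma Box_U_coord_closed:
  assumes "s \<in> S"
  shows "Box (two_power S) (U_coord S s) \<in> carrier (dual_algebra (CC (two_power S)))"
proof -
  let ?X = "two_power S" and ?U = "U_coord S s"
  have "clopenin (topo (CC ?X)) (Box ?X ?U)"
    unfolding clopenin_CC_two_power_iff
  proof (intro conjI exI[of _ "{s}"] ballI impI)
    fix C D assume CD: "C \<in> closed_chains ?X" "D \<in> closed_chains ?X" "trace {s} C = trace {s} D" "C \<in> Box ?X ?U"
    have "d s" if "d \<in> D" for d
      using trace_eqD[OF CD(3)[symmetric] that] CD(4) unfolding mem_Box_U_coord by blast
    then show "D \<in> Box ?X ?U" using CD(2) unfolding mem_Box_U_coord by blast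
  qed (use assms in \<open>auto simp: Box_def\<close>)
  moreover have "upset_of (leq (CC ?X)) (topspace (topo (CC ?X))) (Box ?X ?U)"
    by (auto simp: upset_of_def topspace_CC Box_def leq_CC)
  ultimately show ?thesis by (simp add: carrier_dual_algebra)
qed

lemma generated_closed: "U \<in> generated S \<Longrightarrow> U \<in> carrier (dual_algebra (CC (two_power S)))"
proof (induction rule: generated.induct)
  case (imp U V)
  interpret goedel_algebra "dual_algebra (CC (two_power S))" by (rule goedel_algebra_dual_CC)
  show ?case using imp.IH by (rule imp_closed)
qed (auto intro: Box_U_coord_closed dual_algebra_closed dual_algebra_extremal
    simp flip: topspace_CC)

text \<open>Intersecting with the whole space makes the empty family yield the top element instead
  of \<open>UNIV\<close>.\<close>

lemma generated_INT:
  "finite A \<Longrightarrow> A \<subseteq> generated S \<Longrightarrow> closed_chains (two_power S) \<inter> \<Inter>A \<in> generated S"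
proof (induction A rule: finite_induct)
  case (insert U A)
  have "closed_chains (two_power S) \<inter> \<Inter>(insert U A) = U \<inter> (closed_chains (two_power S) \<inter> \<Inter>A)"
    by auto
  then show ?case using insert by (auto intro: generated.inter)
qed (auto intro: generated.top)

lemma generated_UN: "finite A \<Longrightarrow> A \<subseteq> generated S \<Longrightarrow> \<Union>A \<in> generated S"
  by (induction A rule: finite_induct) (auto intro: generated.bot generated.union)

text \<open>For finite \<open>T\<close> and with \<open>T\<close>, \<open>N\<close> inside
  \<open>S\<close>, this is the box over the set of points that are not both true throughout
  \<open>T\<close> and false throughout \<open>N\<close>, written as a Heyting term in the
  generators.\<close>

definition chain_cond :: "'s set \<Rightarrow> 's set \<Rightarrow> 's set \<Rightarrow> ('s \<Rightarrow> bool) set set" where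
  "chain_cond S T N = imp (dual_algebra (CC (two_power S)))
     (closed_chains (two_power S) \<inter> \<Inter>((\<lambda>s. Box (two_power S) (U_coord S s)) ` T))
     (\<Union>((\<lambda>s. Box (two_power S) (U_coord S s)) ` N))"

lemma chain_cond_generated:
  assumes "finite T" "finite N" "T \<subseteq> S" "N \<subseteq> S"
  shows "chain_cond S T N \<in> generated S"
  unfolding chain_cond_def
  by (intro generated.imp generated_INT generated_UN) (use assms in \<open>auto intro: generated.box\<close>)

lemma mem_imp_CC:
  assumes "U \<in> generated S"
  shows "C \<in> imp (dual_algebra (CC (two_power S))) U V \<longleftrightarrow> C \<in> closed_chains (two_power S) \<and>
    (\<forall>D\<in>closed_chains (two_power S). leq (CC (two_power S)) C D \<longrightarrow> D \<in> U \<longrightarrow> D \<in> V)"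
  using mem_imp_dual_algebra[OF generated_closed[OF assms]] by (simp add: topspace_CC)

text \<open>The implication speaks about chains \<open>D\<close> above \<open>C\<close>, the
  right-hand side about points. From chains to points, it is evaluated at the part of
  \<open>C\<close> above \<open>c\<close>, where a generator holds iff it holds at \<open>c\<close>.
  From points to chains, the condition is applied to the minimum of \<open>D\<close>, at which a
  true coordinate is true on all of \<open>D\<close>.\<close>

lemma mem_chain_cond:
  assumes T: "finite T" "T \<subseteq> S" and N: "N \<subseteq> S"
  shows "C \<in> chain_cond S T N \<longleftrightarrow> C \<in> closed_chains (two_power S) \<and>
    (\<forall>c\<in>C. (\<forall>s\<in>T. c s) \<longrightarrow> (\<exists>s\<in>N. c s))"
proof -
  let ?CC = "closed_chains (two_power S)"
  have gen: "?CC \<inter> \<Inter>((\<lambda>s. Box (two_power S) (U_coord S s)) ` T) \<in> generated S"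
    by (rule generated_INT) (use T in \<open>auto intro: generated.box\<close>)
  have mem: "C \<in> chain_cond S T N \<longleftrightarrow> C \<in> ?CC \<and> (\<forall>D\<in>?CC. leq (CC (two_power S)) C D \<longrightarrow>
      (\<forall>s\<in>T. \<forall>c\<in>D. c s) \<longrightarrow> (\<exists>s\<in>N. \<forall>c\<in>D. c s))"
    unfolding chain_cond_def mem_imp_CC[OF gen] by (auto simp: mem_Box_U_coord)
  show ?thesis
  proof (intro iffI conjI ballI impI)
    assume C: "C \<in> chain_cond S T N"
    then show CC: "C \<in> ?CC" using mem by blast
    fix c assume c: "c \<in> C" "\<forall>s\<in>T. c s"
    let ?E = "{x \<in> C. \<forall>s\<in>S. c s \<longrightarrow> x s}"
    have "\<forall>s\<in>T. \<forall>x\<in>?E. x s" using c T(2) by blast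
    then have "\<exists>s\<in>N. \<forall>x\<in>?E. x s" using C closed_chain_up[OF CC c(1)] unfolding mem by blast
    then show "\<exists>s\<in>N. c s" using c(1) by blast
  next
    assume R: "C \<in> ?CC \<and> (\<forall>c\<in>C. (\<forall>s\<in>T. c s) \<longrightarrow> (\<exists>s\<in>N. c s))"
    have "\<exists>s\<in>N. \<forall>c\<in>D. c s"
      if D: "D \<in> ?CC" "leq (CC (two_power S)) C D" "\<forall>s\<in>T. \<forall>c\<in>D. c s" for D
    proof -
      obtain m where m: "m \<in> D" "\<And>s. s \<in> S \<Longrightarrow> m s \<longleftrightarrow> (\<forall>x\<in>D. x s)"
        by (rule closed_chain_min[OF D(1)]) (rule that; assumption)
      have "m \<in> C" using m(1) D(2) by (auto simp: leq_CC)
      then obtain s where "s \<in> N" "m s" using R D(3) m(1) by blast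
      then show ?thesis using m(2)[of s] N by blast
    qed
    then show "C \<in> chain_cond S T N" using R unfolding mem by blast
  qed
qed

text \<open>A chain avoids, on \<open>F\<close>, the point with trace \<open>d\<close> iff it satisfies the implication from the
  coordinates at which \<open>d\<close> is true to those at which it is false; this is the source of the
  separating elements.\<close>

lemma mem_chain_cond_trace:
  assumes "finite F" "F \<subseteq> S"
  shows "C \<in> chain_cond S {s\<in>F. d s} {s\<in>F. \<not> d s} \<longleftrightarrow>
    C \<in> closed_chains (two_power S) \<and> restrict d F \<notin> trace F C"
proof -
  have T: "finite {s\<in>F. d s}" "{s\<in>F. d s} \<subseteq> S" "{s\<in>F. \<not> d s} \<subseteq> S"
    using assms by auto
  have eq: "((\<forall>s\<in>{s\<in>F. d s}. c s) \<longrightarrow> (\<exists>s\<in>{s\<in>F. \<not> d s}. c s)) \<longleftrightarrow> restrict d F \<noteq> restrict c F" for c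
    unfolding restrict_eq_iff by blast
  show ?thesis
    unfolding mem_chain_cond[OF T] eq trace_def image_iff by blast
qed

text \<open>By \<open>nlift\<close> the conclusion of \<open>trace_lift\<close> fails, so one of its
  hypotheses does. If \<open>sub\<close> fails, \<open>D\<close> shows a restriction that
  \<open>C\<close> lacks; if \<open>up\<close> fails, some \<open>c \<in> C\<close> lies above a
  point of \<open>D\<close> on \<open>F\<close> while its restriction is missing from
  \<open>D\<close>. Each failure yields one kind of separating element.\<close>

lemma clopen_upset_separation:
  assumes F: "finite F" "F \<subseteq> S" and CC: "C \<in> closed_chains (two_power S)" "D \<in> closed_chains (two_power S)"
    and nlift: "\<And>E. \<lbrakk>E \<in> closed_chains (two_power S); leq (CC (two_power S)) C E\<rbrakk> \<Longrightarrow> trace F E \<noteq> trace F D"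
  obtains T N where "T \<subseteq> F" "N \<subseteq> F" "C \<in> chain_cond S T N" "D \<notin> chain_cond S T N"
  | T N t where "T \<subseteq> F" "N \<subseteq> F" "t \<in> F"
    "C \<in> imp (dual_algebra (CC (two_power S))) (chain_cond S T N) (Box (two_power S) (U_coord S t))"
    "D \<notin> imp (dual_algebra (CC (two_power S))) (chain_cond S T N) (Box (two_power S) (U_coord S t))"
proof (cases "trace F D \<subseteq> trace F C")
  case False
  then obtain d where d: "d \<in> D" "restrict d F \<notin> trace F C" unfolding trace_def by blast
  show ?thesis
  proof (rule that(1))
    show "C \<in> chain_cond S {s\<in>F. d s} {s\<in>F. \<not> d s}"
      unfolding mem_chain_cond_trace[OF F] using CC d by simp
    show "D \<notin> chain_cond S {s\<in>F. d s} {s\<in>F. \<not> d s}"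
      unfolding mem_chain_cond_trace[OF F] using d(1) by (simp add: trace_def)
  qed auto
next
  case True
  have "\<exists>c\<in>C. \<exists>d\<in>D. (\<forall>s\<in>F. d s \<longrightarrow> c s) \<and> restrict c F \<notin> trace F D"
  proof (rule ccontr)
    assume neg: "\<not> ?thesis"
    show False
      by (rule trace_lift[OF CC F True]) (use neg nlift in blast)+
  qed
  then obtain c d where c: "c \<in> C" and d: "d \<in> D" and le: "\<forall>s\<in>F. d s \<longrightarrow> c s"
    and new: "restrict c F \<notin> trace F D" by blast
  have "restrict d F \<in> trace F D" using d by (simp add: trace_def)
  then have "restrict d F \<noteq> restrict c F" using new by auto
  then obtain t where t: "t \<in> F" "c t" "\<not> d t" using le unfolding restrict_eq_iff by blast
  \<comment> \<open>\<open>?A\<close> says that the restriction of \<open>c\<close> does not occur.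
    In a chain \<open>E\<close> above \<open>C\<close>, a member false at \<open>t\<close> would lie
    below \<open>c\<close> and pull \<open>c\<close> into the upset \<open>E\<close>; so
    \<open>?A\<close> implies the generator at \<open>t\<close> above \<open>C\<close>. At
    \<open>D\<close> the condition \<open>?A\<close> holds, but \<open>d\<close> violates the
    generator.\<close>
  let ?A = "chain_cond S {s\<in>F. c s} {s\<in>F. \<not> c s}"
  have gen: "?A \<in> generated S" using F by (auto intro!: chain_cond_generated)
  show ?thesis
  proof (rule that(2))
    show "C \<in> imp (dual_algebra (CC (two_power S))) ?A (Box (two_power S) (U_coord S t))"
      unfolding mem_imp_CC[OF gen]
    proof (intro conjI ballI impI)
      fix E assume E: "E \<in> closed_chains (two_power S)" "leq (CC (two_power S)) C E" "E \<in> ?A"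
      have "x t" if x: "x \<in> E" for x
      proof (rule ccontr)
        assume "\<not> x t"
        have "x \<in> C" using x E(2) by (auto simp: leq_CC)
        then have "(\<forall>i\<in>S. x i \<longrightarrow> c i) \<or> (\<forall>i\<in>S. c i \<longrightarrow> x i)"
          using CC(1) c unfolding closed_chains_two_power_iff by blast
        then have "\<forall>i\<in>S. x i \<longrightarrow> c i" using t \<open>\<not> x t\<close> F(2) by blast
        then have "c \<in> E" using E(2) c x unfolding leq_CC upset_of_def leq_two_power by blast
        then have "restrict c F \<in> trace F E" by (simp add: trace_def)
        then show False using E(3) unfolding mem_chain_cond_trace[OF F] by blast
      qed
      then show "E \<in> Box (two_power S) (U_coord S t)" using E(1) unfolding mem_Box_U_coord by blast
    qed (fact CC(1))
    have "D \<in> ?A" unfolding mem_chain_cond_trace[OF F] using CC(2) new by blast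
    moreover have "D \<notin> Box (two_power S) (U_coord S t)" unfolding mem_Box_U_coord using d t by blast
    ultimately show "D \<notin> imp (dual_algebra (CC (two_power S))) ?A (Box (two_power S) (U_coord S t))"
      unfolding mem_imp_CC[OF gen] using CC(2) leq_CC_refl by blast
  qed (use t in auto)
qed

lemma carrier_dual_CC: "carrier (dual_algebra (CC (two_power S))) = generated S"
proof
  show "generated S \<subseteq> carrier (dual_algebra (CC (two_power S)))" using generated_closed by blast
  show "carrier (dual_algebra (CC (two_power S))) \<subseteq> generated S"
  proof
    fix U assume U: "U \<in> carrier (dual_algebra (CC (two_power S)))"
    then have "clopenin (topo (CC (two_power S))) U" by (simp add: carrier_dual_algebra)
    then obtain F where sub: "U \<subseteq> closed_chains (two_power S)" and F: "finite F" "F \<subseteq> S"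
      and dep: "\<And>C D. \<lbrakk>C \<in> closed_chains (two_power S); D \<in> closed_chains (two_power S);
        trace F C = trace F D; C \<in> U\<rbrakk> \<Longrightarrow> D \<in> U"
      unfolding clopenin_CC_two_power_iff by blast
    define a where "a = (\<lambda>(T, N). chain_cond S T N)"
    define b where "b = (\<lambda>((T, N), t). imp (dual_algebra (CC (two_power S))) (chain_cond S T N)
      (Box (two_power S) (U_coord S t)))"
    \<comment> \<open>All separating elements over \<open>F\<close>; there are finitely many since
      \<open>T\<close>, \<open>N\<close> and \<open>t\<close> come from the finite set
      \<open>F\<close>.\<close>
    define A where "A = a ` (Pow F \<times> Pow F) \<union> b ` ((Pow F \<times> Pow F) \<times> F)"
    have finA: "finite A" unfolding A_def using F(1) by simp
    have cc: "chain_cond S T N \<in> generated S" if "T \<subseteq> F" "N \<subseteq> F" for T N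
      by (rule chain_cond_generated) (use that F finite_subset[of _ F] in auto)
    have genA: "A \<subseteq> generated S"
      unfolding A_def a_def b_def using cc F(2) by (auto intro!: generated.imp generated.box)
    have sep: "\<exists>V\<in>A. C \<in> V \<and> D \<notin> V"
      if C: "C \<in> U" and D: "D \<in> closed_chains (two_power S)" "D \<notin> U" for C D
    proof -
      have C': "C \<in> closed_chains (two_power S)" using C sub by blast
      have nlift: "trace F E \<noteq> trace F D" if E: "E \<in> closed_chains (two_power S)" "leq (CC (two_power S)) C E" for E
        using dep[OF E(1) D(1)] dual_algebra_upset(2)[OF U C, unfolded topspace_CC, OF E] D(2) by blast
      show ?thesis
      proof (rule clopen_upset_separation[OF F C' D(1) nlift])
        fix T N assume "T \<subseteq> F" "N \<subseteq> F" and *: "C \<in> chain_cond S T N" "D \<notin> chain_cond S T N"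
        then have "a (T, N) \<in> A" by (simp add: A_def)
        then show ?thesis using * unfolding a_def by auto
      next
        fix T N t assume "T \<subseteq> F" "N \<subseteq> F" "t \<in> F"
          and *: "C \<in> imp (dual_algebra (CC (two_power S))) (chain_cond S T N) (Box (two_power S) (U_coord S t))"
            "D \<notin> imp (dual_algebra (CC (two_power S))) (chain_cond S T N) (Box (two_power S) (U_coord S t))"
        then have "b ((T, N), t) \<in> A" by (simp add: A_def)
        then show ?thesis using * unfolding b_def by auto
      qed
    qed
    define h where "h = (\<lambda>B. closed_chains (two_power S) \<inter> \<Inter>B)"
    \<comment> \<open>The meet of all members of \<open>A\<close> containing \<open>C\<close> stays
      inside \<open>U\<close> by \<open>sep\<close>. Although \<open>U\<close> may be infinite, only
      finitely many subfamilies of \<open>A\<close> arise, so the union is a finite join.\<close>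
    have "U = \<Union>(h ` ((\<lambda>C. {V \<in> A. C \<in> V}) ` U))"
    proof
      show "U \<subseteq> \<Union>(h ` ((\<lambda>C. {V \<in> A. C \<in> V}) ` U))" using sub by (auto simp: h_def)
      show "\<Union>(h ` ((\<lambda>C. {V \<in> A. C \<in> V}) ` U)) \<subseteq> U"
      proof
        fix D assume "D \<in> \<Union>(h ` ((\<lambda>C. {V \<in> A. C \<in> V}) ` U))"
        then obtain C where C: "C \<in> U" "D \<in> closed_chains (two_power S)" "\<And>V. \<lbrakk>V \<in> A; C \<in> V\<rbrakk> \<Longrightarrow> D \<in> V"
          by (auto simp: h_def)
        then show "D \<in> U" using sep[OF C(1,2)] by blast
      qed
    qed
    moreover have "finite ((\<lambda>C. {V \<in> A. C \<in> V}) ` U)"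
      by (rule finite_subset[of _ "Pow A"]) (use finA in auto)
    then have "\<Union>(h ` ((\<lambda>C. {V \<in> A. C \<in> V}) ` U)) \<in> generated S"
    proof (intro generated_UN, rule finite_imageI)
      have "h {V \<in> A. C \<in> V} \<in> generated S" for C
        unfolding h_def by (rule generated_INT) (use finA genA in auto)
      then show "h ` (\<lambda>C. {V \<in> A. C \<in> V}) ` U \<subseteq> generated S" by blast
    qed
    ultimately show "U \<in> generated S" by simp
  qed
qed

section \<open>The homomorphism extending a map on generators\<close>

context goedel_algebra
begin

definition point :: "'s set \<Rightarrow> ('s \<Rightarrow> 'a) \<Rightarrow> 'a set \<Rightarrow> 's \<Rightarrow> bool" where
  "point S f q = (\<lambda>s\<in>S. f s \<in> q)"

definition path :: "'s set \<Rightarrow> ('s \<Rightarrow> 'a) \<Rightarrow> 'a set \<Rightarrow> ('s \<Rightarrow> bool) set" where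
  "path S f p = point S f ` {q. prime_filter q \<and> p \<subseteq> q}"

lemma point_apply [simp]: "s \<in> S \<Longrightarrow> point S f q s \<longleftrightarrow> f s \<in> q"
  by (simp add: point_def)

lemma point_extensional [simp]: "point S f q \<in> extensional S"
  by (simp add: point_def)

lemma prime_filterD:
  assumes "prime_filter p"
  shows "is_filter p" "\<bottom> \<notin> p"
  using assms by (auto simp: prime_filter_def)

text \<open>Totality comes from the comparability of filters above \<open>p\<close>. For closedness,
  a point approximated on all finite sets must be realized by one filter; being proper and above
  \<open>p\<close>, that filter is automatically prime.\<close>

lemma path_closed_chain:
  assumes p: "prime_filter p" and f: "f \<in> S \<rightarrow> carrier L"
  shows "path S f p \<in> closed_chains (two_power S)"
  unfolding closed_chains_two_power_iff
proof (intro conjI ballI impI)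
  show "path S f p \<noteq> {}" using p by (auto simp: path_def)
  show "path S f p \<subseteq> extensional S" by (auto simp: path_def)
next
  fix x y assume "x \<in> path S f p" "y \<in> path S f p"
  then obtain q r where q: "prime_filter q" "p \<subseteq> q" "x = point S f q"
    and r: "prime_filter r" "p \<subseteq> r" "y = point S f r"
    by (auto simp: path_def)
  then have "q \<subseteq> r \<or> r \<subseteq> q"
    using prime_filters_above_total[OF p] prime_filterD by blast
  then show "(\<forall>i\<in>S. x i \<longrightarrow> y i) \<or> (\<forall>i\<in>S. y i \<longrightarrow> x i)"
    unfolding q(3) r(3) by (auto simp: subset_iff)
next
  fix m assume m: "m \<in> extensional S" "\<forall>F. finite F \<longrightarrow> F \<subseteq> S \<longrightarrow> (\<exists>x\<in>path S f p. \<forall>s\<in>F. x s = m s)"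
  define above where "above = (\<lambda>F q. prime_filter q \<and> p \<subseteq> q \<and> f ` F \<subseteq> q)"
  text \<open>The prime filter realizing \<open>m\<close> is generated by \<open>p\<close> and the generators at which \<open>m\<close> is true.\<close>
  define q where "q = {h \<in> carrier L. \<exists>F. finite F \<and> F \<subseteq> {s\<in>S. m s} \<and> (\<forall>r. above F r \<longrightarrow> h \<in> r)}"
  \<comment> \<open>\<open>F\<close> carries the conditions that put an element into
    \<open>q\<close>; \<open>G\<close> adds coordinates where \<open>r\<close> must match
    \<open>m\<close> even if \<open>m\<close> is false there. \<open>G = {}\<close> will show that
    \<open>q\<close> is proper, and \<open>G = {s}\<close> that \<open>f s \<in> q\<close> forces
    \<open>m s\<close>.\<close>
  have ex: "\<exists>r. above F r \<and> (\<forall>s\<in>G. f s \<in> r \<longleftrightarrow> m s)"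
    if FG: "finite F" "F \<subseteq> {s\<in>S. m s}" "finite G" "G \<subseteq> S" for F G
  proof -
    have "finite (F \<union> G)" "F \<union> G \<subseteq> S" using FG by auto
    then obtain x where x: "x \<in> path S f p" "\<forall>s\<in>F \<union> G. x s = m s" using m(2) by blast
    then obtain r where r: "prime_filter r" "p \<subseteq> r" "x = point S f r" by (auto simp: path_def)
    have "f s \<in> r \<longleftrightarrow> m s" if "s \<in> F \<union> G" for s
      using x(2) that \<open>F \<union> G \<subseteq> S\<close> r(3) by (metis point_apply subsetD)
    then show ?thesis using r FG(2) unfolding above_def by (intro exI[of _ r]) auto
  qed
  have D: "is_filter r" "p \<subseteq> r" "f ` F \<subseteq> r" if "above F r" for F r
    using that prime_filterD by (auto simp: above_def)
  have "is_filter q"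
    unfolding is_filter_def
  proof (intro conjI ballI impI)
    show "q \<subseteq> carrier L" by (auto simp: q_def)
    show "\<top> \<in> q" unfolding q_def using is_filterD(2)[OF D(1)] by blast
    show "y \<in> q" if xy: "x \<in> q" "y \<in> carrier L" "x \<sqsubseteq> y" for x y
    proof -
      obtain F where F: "finite F" "F \<subseteq> {s\<in>S. m s}" "\<forall>r. above F r \<longrightarrow> x \<in> r"
        using xy(1) unfolding q_def by blast
      then have "\<forall>r. above F r \<longrightarrow> y \<in> r"
        using is_filterD(4)[OF D(1) _ that(3,2)] by simp
      then show ?thesis using F(1,2) that(2) unfolding q_def by blast
    qed
    fix x y assume "x \<in> q" "y \<in> q"
    then obtain F G where F: "x \<in> carrier L" "finite F" "F \<subseteq> {s\<in>S. m s}" "\<And>r. above F r \<Longrightarrow> x \<in> r"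
      and G: "y \<in> carrier L" "finite G" "G \<subseteq> {s\<in>S. m s}" "\<And>r. above G r \<Longrightarrow> y \<in> r"
      unfolding q_def by blast
    have "x \<sqinter> y \<in> r" if "above (F \<union> G) r" for r
    proof -
      have "above F r" "above G r" using that by (auto simp: above_def)
      then show ?thesis using F(4) G(4) is_filterD(3) D(1) by blast
    qed
    moreover have "finite (F \<union> G)" "F \<union> G \<subseteq> {s\<in>S. m s}" "x \<sqinter> y \<in> carrier L"
      using F G by auto
    ultimately show "x \<sqinter> y \<in> q" unfolding q_def by blast
  qed
  moreover have pq: "p \<subseteq> q"
  proof
    fix h assume h: "h \<in> p"
    then have "h \<in> carrier L" using is_filterD(1)[OF prime_filterD(1)[OF p]] by blast
    moreover have "h \<in> r" if "above {} r" for r using D(2)[OF that] h by blast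
    ultimately show "h \<in> q" unfolding q_def by blast
  qed
  moreover have "\<bottom> \<notin> q"
  proof
    assume "\<bottom> \<in> q"
    then obtain F where F: "finite F" "F \<subseteq> {s\<in>S. m s}" "\<And>r. above F r \<Longrightarrow> \<bottom> \<in> r"
      unfolding q_def by blast
    then obtain r where "above F r" using ex[of F "{}"] by auto
    then show False using F(3) prime_filterD(2) by (auto simp: above_def)
  qed
  ultimately have q: "prime_filter q" using prime_filter_superset[OF p] by blast
  have "f s \<in> q \<longleftrightarrow> m s" if s: "s \<in> S" for s
  proof
    assume "f s \<in> q"
    then obtain F where F: "finite F" "F \<subseteq> {s\<in>S. m s}" "\<And>r. above F r \<Longrightarrow> f s \<in> r"
      unfolding q_def by blast
    then obtain r where "above F r" "f s \<in> r \<longleftrightarrow> m s" using ex[of F "{s}"] s by auto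
    then show "m s" using F(3) by blast
  next
    assume "m s"
    then have "{s} \<subseteq> {s\<in>S. m s}" "finite {s}" using s by auto
    moreover have "f s \<in> r" if "above {s} r" for r using D(3)[OF that] by simp
    moreover have "f s \<in> carrier L" using f s by blast
    ultimately show "f s \<in> q" unfolding q_def by blast
  qed
  then have "m = point S f q"
    by (intro extensionalityI[OF m(1) point_extensional]) simp
  then show "m \<in> path S f p" using q pq unfolding path_def by blast
qed

text \<open>For the upset part, the filters behind \<open>x\<close> and \<open>y\<close> are
  comparable. If that of \<open>y\<close> is the smaller one, then \<open>y\<close> is below
  \<open>x\<close> as well, and the two points coincide.\<close>

lemma path_above:
  assumes p: "prime_filter p" and q: "prime_filter q" "p \<subseteq> q"
  shows "leq (CC (two_power S)) (path S f p) (path S f q)"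
  unfolding leq_CC upset_of_def leq_two_power
proof (intro conjI ballI impI)
  show "path S f q \<subseteq> path S f p" "path S f q \<subseteq> path S f p"
    using q(2) unfolding path_def by blast+
  fix x y assume x: "x \<in> path S f q" and y: "y \<in> path S f p" and le: "\<forall>i\<in>S. x i \<longrightarrow> y i"
  obtain q' where q': "prime_filter q'" "q \<subseteq> q'" "x = point S f q'" using x by (auto simp: path_def)
  obtain p' where p': "prime_filter p'" "p \<subseteq> p'" "y = point S f p'" using y by (auto simp: path_def)
  have "q' \<subseteq> p' \<or> p' \<subseteq> q'"
    using prime_filters_above_total[OF p] prime_filterD(1) q' p' q(2) by (meson subset_trans)
  then show "y \<in> path S f q"
  proof
    assume "q' \<subseteq> p'"
    then show ?thesis using p' q'(2) unfolding path_def by blast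
  next
    assume "p' \<subseteq> q'"
    then have "y = x"
      using le unfolding q'(3) p'(3)
      by (intro extensionalityI[OF point_extensional point_extensional]) auto
    then show ?thesis using x by simp
  qed
qed

text \<open>The witness is the intersection of all prime filters above \<open>p\<close> whose points lie in \<open>D\<close>.\<close>

lemma above_path:
  assumes p: "prime_filter p"
    and D: "D \<in> closed_chains (two_power S)" "leq (CC (two_power S)) (path S f p) D"
  obtains q where "prime_filter q" "p \<subseteq> q" "D = path S f q"
proof -
  define \<F> where "\<F> = {q. prime_filter q \<and> p \<subseteq> q \<and> point S f q \<in> D}"
  have sub: "D \<subseteq> path S f p" using D(2) by (simp add: leq_CC)
  have D_eq: "D = point S f ` \<F>" using sub unfolding \<F>_def path_def by blast
  have "D \<noteq> {}" using D(1) by (simp add: closed_chains_two_power_iff)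
  then obtain q0 where q0: "q0 \<in> \<F>" using D_eq by blast
  have fil: "is_filter q" "p \<subseteq> q" "\<bottom> \<notin> q" if "q \<in> \<F>" for q
    using that prime_filterD by (auto simp: \<F>_def)
  have "is_filter (\<Inter>\<F>)"
    unfolding is_filter_def
  proof (intro conjI ballI impI)
    show "\<Inter>\<F> \<subseteq> carrier L" using is_filterD(1)[OF fil(1)[OF q0]] q0 by blast
  qed (use is_filterD(2-4)[OF fil(1)] in blast)+
  then have q: "prime_filter (\<Inter>\<F>)"
    using prime_filter_superset[OF p, of "\<Inter>\<F>"] fil q0 by blast
  have pq: "p \<subseteq> \<Inter>\<F>" using fil(2) by blast
  \<comment> \<open>The point of an intersection of filters is the coordinatewise minimum of their
    points; closedness of \<open>D\<close> keeps this minimum in \<open>D\<close>.\<close>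
  obtain m where m: "m \<in> D" "\<And>s. s \<in> S \<Longrightarrow> m s \<longleftrightarrow> (\<forall>x\<in>D. x s)"
    by (rule closed_chain_min[OF D(1)]) (rule that; assumption)
  have "point S f (\<Inter>\<F>) s \<longleftrightarrow> m s" if "s \<in> S" for s
    using that unfolding m(2)[OF that] D_eq by simp
  then have "point S f (\<Inter>\<F>) = m"
    using mem_closed_chain_extensional[OF D(1) m(1)]
    by (intro extensionalityI[of _ S]) auto
  then have mem: "point S f (\<Inter>\<F>) \<in> D" using m(1) by simp
  have "D = path S f (\<Inter>\<F>)"
  proof
    show "D \<subseteq> path S f (\<Inter>\<F>)"
    proof
      fix x assume "x \<in> D"
      then obtain r where r: "r \<in> \<F>" "x = point S f r" using D_eq by blast
      then have "prime_filter r" "\<Inter>\<F> \<subseteq> r" by (auto simp: \<F>_def)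
      then show "x \<in> path S f (\<Inter>\<F>)" using r(2) unfolding path_def by blast
    qed
    show "path S f (\<Inter>\<F>) \<subseteq> D"
    proof
      fix y assume "y \<in> path S f (\<Inter>\<F>)"
      then obtain r where r: "prime_filter r" "\<Inter>\<F> \<subseteq> r" "y = point S f r" by (auto simp: path_def)
      then have "y \<in> path S f p" using pq unfolding path_def by blast
      moreover have "\<forall>i\<in>S. point S f (\<Inter>\<F>) i \<longrightarrow> y i" using r(2) unfolding r(3) by auto
      ultimately show "y \<in> D"
        using D(2) mem unfolding leq_CC upset_of_def leq_two_power by blast
    qed
  qed
  then show ?thesis using that q pq by blast
qed

text \<open>By the separation property of prime filters there is at most one such \<open>h\<close>; it is the value at
  \<open>U\<close> of the homomorphism extending \<open>f\<close>.\<close>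

definition represents :: "'s set \<Rightarrow> ('s \<Rightarrow> 'a) \<Rightarrow> ('s \<Rightarrow> bool) set set \<Rightarrow> 'a \<Rightarrow> bool" where
  "represents S f U h \<longleftrightarrow> h \<in> carrier L \<and> (\<forall>p. prime_filter p \<longrightarrow> (path S f p \<in> U \<longleftrightarrow> h \<in> p))"

lemma represents_unique: "represents S f U h \<Longrightarrow> represents S f U k \<Longrightarrow> h = k"
  unfolding represents_def by (blast intro: eq_if_same_prime_filters)

lemma represents_Box:
  assumes f: "f \<in> S \<rightarrow> carrier L" and s: "s \<in> S"
  shows "represents S f (Box (two_power S) (U_coord S s)) (f s)"
  unfolding represents_def mem_Box_U_coord
  using path_closed_chain[OF _ f] f s by (auto simp: path_def)

lemma represents_bot: "represents S f {} \<bottom>"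
  unfolding represents_def using prime_filterD(2) by auto

lemma represents_top:
  assumes f: "f \<in> S \<rightarrow> carrier L"
  shows "represents S f (closed_chains (two_power S)) \<top>"
  unfolding represents_def
  using path_closed_chain[OF _ f] is_filterD(2)[OF prime_filterD(1)] by auto

lemma represents_Int:
  assumes "represents S f U h" "represents S f V k"
  shows "represents S f (U \<inter> V) (h \<sqinter> k)"
  using assms unfolding represents_def by (auto simp: filter_meet_iff prime_filterD(1))

lemma represents_Un:
  assumes "represents S f U h" "represents S f V k"
  shows "represents S f (U \<union> V) (h \<squnion> k)"
  using assms unfolding represents_def by (auto simp: prime_filter_join_iff)

text \<open>\<open>path_above\<close> and \<open>above_path\<close> turn the quantifier over closed
  chains above \<open>path S f p\<close> into one over prime filters above \<open>p\<close>; what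
  remains is \<open>prime_filter_imp_iff\<close>.\<close>

lemma represents_imp:
  assumes f: "f \<in> S \<rightarrow> carrier L" and U: "U \<in> generated S"
    and h: "represents S f U h" and k: "represents S f V k"
  shows "represents S f (imp (dual_algebra (CC (two_power S))) U V) (h \<Rrightarrow> k)"
  unfolding represents_def
proof (intro conjI allI impI)
  have hk: "h \<in> carrier L" "k \<in> carrier L" using h k by (auto simp: represents_def)
  then show "h \<Rrightarrow> k \<in> carrier L" by (rule imp_closed)
  fix p assume p: "prime_filter p"
  have "path S f p \<in> imp (dual_algebra (CC (two_power S))) U V \<longleftrightarrow>
      (\<forall>D\<in>closed_chains (two_power S). leq (CC (two_power S)) (path S f p) D \<longrightarrow> D \<in> U \<longrightarrow> D \<in> V)"
    unfolding mem_imp_CC[OF U] using path_closed_chain[OF p f] by simp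
  also have "\<dots> \<longleftrightarrow> (\<forall>q. prime_filter q \<and> p \<subseteq> q \<longrightarrow> path S f q \<in> U \<longrightarrow> path S f q \<in> V)"
  proof (intro iffI ballI allI impI)
    fix q assume *: "\<forall>D\<in>closed_chains (two_power S). leq (CC (two_power S)) (path S f p) D \<longrightarrow> D \<in> U \<longrightarrow> D \<in> V"
      and q: "prime_filter q \<and> p \<subseteq> q" and "path S f q \<in> U"
    then show "path S f q \<in> V"
      using path_closed_chain[OF _ f, of q] path_above[OF p, of q S f] by simp
  next
    fix D assume *: "\<forall>q. prime_filter q \<and> p \<subseteq> q \<longrightarrow> path S f q \<in> U \<longrightarrow> path S f q \<in> V"
      and D: "D \<in> closed_chains (two_power S)" "leq (CC (two_power S)) (path S f p) D" and "D \<in> U"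
    show "D \<in> V"
      by (rule above_path[OF p D]) (use * \<open>D \<in> U\<close> in simp)
  qed
  also have "\<dots> \<longleftrightarrow> (\<forall>q. prime_filter q \<and> p \<subseteq> q \<longrightarrow> h \<in> q \<longrightarrow> k \<in> q)"
    using h k unfolding represents_def by simp
  also have "\<dots> \<longleftrightarrow> h \<Rrightarrow> k \<in> p"
    using prime_filter_imp_iff[OF p hk] by simp
  finally show "path S f p \<in> imp (dual_algebra (CC (two_power S))) U V \<longleftrightarrow> h \<Rrightarrow> k \<in> p" .
qed

lemma represents_exists:
  assumes f: "f \<in> S \<rightarrow> carrier L" and "U \<in> generated S"
  shows "\<exists>h. represents S f U h"
  using assms(2)
proof (induction rule: generated.induct)
  case (imp U V)
  then show ?case using represents_imp[OF f] by blast
qed (use represents_Box[OF f] represents_bot represents_top[OF f] represents_Int represents_Un in blast)+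

end

section \<open>Uniqueness of the extension and freeness\<close>

lemma heyting_homD:
  assumes "h \<in> heyting_hom G H"
  shows "\<And>x. x \<in> carrier G \<Longrightarrow> h x \<in> carrier H" "h \<bottom>\<^bsub>G\<^esub> = \<bottom>\<^bsub>H\<^esub>" "h \<top>\<^bsub>G\<^esub> = \<top>\<^bsub>H\<^esub>"
    "\<And>x y. \<lbrakk>x \<in> carrier G; y \<in> carrier G\<rbrakk> \<Longrightarrow> h (x \<sqinter>\<^bsub>G\<^esub> y) = h x \<sqinter>\<^bsub>H\<^esub> h y"
    "\<And>x y. \<lbrakk>x \<in> carrier G; y \<in> carrier G\<rbrakk> \<Longrightarrow> h (x \<squnion>\<^bsub>G\<^esub> y) = h x \<squnion>\<^bsub>H\<^esub> h y"
    "\<And>x y. \<lbrakk>x \<in> carrier G; y \<in> carrier G\<rbrakk> \<Longrightarrow> h (imp G x y) = imp H (h x) (h y)"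
  using assms by (auto simp: heyting_hom_def)

lemma heyting_hom_dual_CC_eq:
  fixes S :: "'s set"
  defines "G \<equiv> dual_algebra (CC (two_power S))"
  assumes g: "g \<in> heyting_hom G H" "g \<in> extensional (carrier G)"
    and h: "h \<in> heyting_hom G H" "h \<in> extensional (carrier G)"
    and eq: "\<And>s. s \<in> S \<Longrightarrow> g (Box (two_power S) (U_coord S s)) = h (Box (two_power S) (U_coord S s))"
  shows "g = h"
proof (rule extensionalityI[OF g(2) h(2)])
  note ops = dual_algebra_operations[where Y = "CC (two_power S)", folded G_def, unfolded topspace_CC]
  have car: "U \<in> carrier G" if "U \<in> generated S" for U
    using generated_closed[OF that] by (simp add: G_def)
  fix U assume "U \<in> carrier G"
  then have "U \<in> generated S" by (simp add: G_def carrier_dual_CC)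
  then show "g U = h U"
  proof (induction rule: generated.induct)
    case (box s)
    then show ?case by (rule eq)
  next
    case bot
    show ?case using heyting_homD(2)[OF g(1)] heyting_homD(2)[OF h(1)] ops(3) by simp
  next
    case top
    show ?case using heyting_homD(3)[OF g(1)] heyting_homD(3)[OF h(1)] ops(4) by simp
  next
    case (inter U V)
    then show ?case
      using heyting_homD(4)[OF g(1), of U V] heyting_homD(4)[OF h(1), of U V] ops(2)[of U V] car by simp
  next
    case (union U V)
    then show ?case
      using heyting_homD(5)[OF g(1), of U V] heyting_homD(5)[OF h(1), of U V] ops(1)[of U V] car by simp
  next
    case (imp U V)
    then show ?case
      using heyting_homD(6)[OF g(1), of U V] heyting_homD(6)[OF h(1), of U V] car
      by (simp add: G_def)
  qed
qed

theorem theorem3p22: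
  fixes S :: "'s set"
  shows "free_goedel_over TYPE('h) S
           (\<lambda>s. Box (two_power S) (U_coord S s)) (dual_algebra (CC (two_power S)))"
  unfolding free_goedel_over_def
proof (intro conjI allI impI)
  let ?G = "dual_algebra (CC (two_power S))"
  show "goedel_algebra ?G" by (rule goedel_algebra_dual_CC)
  show "(\<lambda>s. Box (two_power S) (U_coord S s)) \<in> S \<rightarrow> carrier ?G"
    by (intro Pi_I Box_U_coord_closed)
  fix H :: "'h heyting" and f :: "'s \<Rightarrow> 'h"
  assume Hf: "goedel_algebra H \<and> f \<in> S \<rightarrow> carrier H"
  interpret H: goedel_algebra H using Hf by blast
  have f: "f \<in> S \<rightarrow> carrier H" using Hf by blast
  define g where "g = (\<lambda>U\<in>carrier ?G. THE h. H.represents S f U h)"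
  have rep: "H.represents S f U (g U)" if "U \<in> carrier ?G" for U
  proof -
    have "\<exists>h. H.represents S f U h"
      using H.represents_exists[OF f] that by (simp add: carrier_dual_CC)
    then have "H.represents S f U (THE h. H.represents S f U h)"
      using H.represents_unique by (metis theI)
    then show ?thesis using that by (simp add: g_def)
  qed
  \<comment> \<open>Each homomorphism law thereby reduces to showing that its right-hand side
    represents the argument on its left.\<close>
  have gI: "g U = h" if "U \<in> carrier ?G" "H.represents S f U h" for U h
    using H.represents_unique[OF rep[OF that(1)] that(2)] .
  interpret G: goedel_algebra ?G by (rule goedel_algebra_dual_CC)
  note ops = dual_algebra_operations[where Y = "CC (two_power S)", unfolded topspace_CC]
  have hom: "g \<in> heyting_hom ?G H"
    unfolding heyting_hom_def
  proof (intro CollectI conjI ballI)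
    show "g \<in> carrier ?G \<rightarrow> carrier H" using rep by (auto simp: H.represents_def)
    show "g \<bottom>\<^bsub>?G\<^esub> = \<bottom>\<^bsub>H\<^esub>" by (rule gI) (simp_all add: ops(3) H.represents_bot dual_algebra_extremal)
    show "g \<top>\<^bsub>?G\<^esub> = \<top>\<^bsub>H\<^esub>"
      by (rule gI[OF G.top_closed]) (simp add: ops(4) H.represents_top[OF f])
    fix U V assume UV: "U \<in> carrier ?G" "V \<in> carrier ?G"
    show "g (U \<sqinter>\<^bsub>?G\<^esub> V) = g U \<sqinter>\<^bsub>H\<^esub> g V"
      by (rule gI[OF G.meet_closed[OF UV]]) (simp add: ops(2)[OF UV] H.represents_Int rep UV)
    show "g (U \<squnion>\<^bsub>?G\<^esub> V) = g U \<squnion>\<^bsub>H\<^esub> g V"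
      by (rule gI[OF G.join_closed[OF UV]]) (simp add: ops(1)[OF UV] H.represents_Un rep UV)
    show "g (imp ?G U V) = imp H (g U) (g V)"
      by (rule gI[OF G.imp_closed[OF UV] H.represents_imp[OF f _ rep rep]])
        (use UV in \<open>simp_all add: carrier_dual_CC\<close>)
  qed
  have ext: "g \<in> extensional (carrier ?G)" by (simp add: g_def)
  have val: "g (Box (two_power S) (U_coord S s)) = f s" if "s \<in> S" for s
    by (rule gI[OF Box_U_coord_closed[OF that] H.represents_Box[OF f that]])
  show "\<exists>!g. g \<in> heyting_hom ?G H \<and> g \<in> extensional (carrier ?G) \<and>
      (\<forall>s\<in>S. g (Box (two_power S) (U_coord S s)) = f s)"
  proof (rule ex1I[of _ g])
    show "g \<in> heyting_hom ?G H \<and> g \<in> extensional (carrier ?G) \<and>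
        (\<forall>s\<in>S. g (Box (two_power S) (U_coord S s)) = f s)"
      using hom ext val by blast
    fix k assume k: "k \<in> heyting_hom ?G H \<and> k \<in> extensional (carrier ?G) \<and>
        (\<forall>s\<in>S. k (Box (two_power S) (U_coord S s)) = f s)"
    then show "k = g"
      using heyting_hom_dual_CC_eq[of k S H g] hom ext val by simp
  qed
qed

end
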